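(* Let $1<p<\infty$, $p\neq2$. Let $S_p$ be the unit sphere of the real Banach space $L^p[0,1]$, with the norm metric, let $B_p^w$ be the closed unit ball of $L^p[0,1]$ endowed with the weak topology, and let $\nu_p\colon S_p\to B_p^w$ be the inclusion map. Let $G$ be the group of surjective linear isometries of $L^p[0,1]$ with the strong operator topology. Then the Gromov compactification of $S_p$ is not a factor of $\nu_p\colon S_p\to B_p^w$. In particular, $\nu_p$ is neither the maximal equivariant compactification (for the action of $G$) nor the Gromov compactification of $S_p$.
   Context: A $G$-space is a Tychonoff space $X$ with a continuous left action of the topological group $G$. An equivariant compactification of $X$ is a compact Hausdorff $G$-space $K$ with a continuous $G$-equivariant map $\nu\colon X\to K$ with dense image. A compactification $\nu'\colon X\to K'$ is a factor of $\nu\colon X\to K$ if there is a continuous $\pi\colon K\to K'$ with $\pi\circ\nu=\nu'$; compactifications are identified up to equivalence, i.e. if each is a factor of the other. The maximal equivariant compactification is the one of which every equivariant compactification is a factor. (The map $\nu_p$ is an equivariant compactification of $S_p$.) Gromov compactification of a bounded metric space $(X,d)$: the compactification corresponding to the closed unital subalgebra of the algebra of bounded continuous real functions on $X$ generated by the functions $x\mapsto d(x,z)$, $z\in X$. *)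

theory Defs
  imports "HOL-Analysis.Analysis" "HOL-Algebra.Group"
begin

section \<open>Compactifications, \<open>G\<close>-spaces and Gromov compactifications\<close>

text \<open>As usual for equivariant compactifications, the map into the compact space is not required
  to be an embedding. A compactification of \<open>X\<close> is a pair \<open>(K, \<nu>)\<close>.\<close>

definition compactification :: "'a topology \<Rightarrow> 'k topology \<Rightarrow> ('a \<Rightarrow> 'k) \<Rightarrow> bool" where
  "compactification X K \<nu> \<longleftrightarrow>
     compact_space K \<and> Hausdorff_space K \<and> continuous_map X K \<nu> \<and>
     K closure_of (\<nu> ` topspace X) = topspace K"

text \<open>\<open>(K', \<nu>')\<close> is a factor of \<open>(K, \<nu>)\<close>.\<close>

definition compactification_factor ::
  "'a topology \<Rightarrow> 'l topology \<Rightarrow> ('a \<Rightarrow> 'l) \<Rightarrow> 'k topology \<Rightarrow> ('a \<Rightarrow> 'k) \<Rightarrow> bool" where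
  "compactification_factor X K' \<nu>' K \<nu> \<longleftrightarrow>
     (\<exists>\<pi>. continuous_map K K' \<pi> \<and> (\<forall>x\<in>topspace X. \<pi> (\<nu> x) = \<nu>' x))"

definition topological_group :: "('g, 'm) monoid_scheme \<Rightarrow> 'g topology \<Rightarrow> bool" where
  "topological_group G \<tau> \<longleftrightarrow>
     group G \<and> topspace \<tau> = carrier G \<and>
     continuous_map (prod_topology \<tau> \<tau>) \<tau> (\<lambda>(g, h). g \<otimes>\<^bsub>G\<^esub> h) \<and>
     continuous_map \<tau> \<tau> (\<lambda>g. inv\<^bsub>G\<^esub> g)"

definition tychonoff_space :: "'a topology \<Rightarrow> bool" where
  "tychonoff_space X \<longleftrightarrow> completely_regular_space X \<and> Hausdorff_space X"

definition G_space ::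
  "('g, 'm) monoid_scheme \<Rightarrow> 'g topology \<Rightarrow> 'a topology \<Rightarrow> ('g \<Rightarrow> 'a \<Rightarrow> 'a) \<Rightarrow> bool" where
  "G_space G \<tau> X act \<longleftrightarrow>
     topological_group G \<tau> \<and> tychonoff_space X \<and>
     continuous_map (prod_topology \<tau> X) X (\<lambda>(g, x). act g x) \<and>
     (\<forall>x\<in>topspace X. act \<one>\<^bsub>G\<^esub> x = x) \<and>
     (\<forall>g\<in>carrier G. \<forall>h\<in>carrier G. \<forall>x\<in>topspace X. act (g \<otimes>\<^bsub>G\<^esub> h) x = act g (act h x))"

definition equivariant_compactification ::
  "('g, 'm) monoid_scheme \<Rightarrow> 'g topology \<Rightarrow> 'a topology \<Rightarrow> ('g \<Rightarrow> 'a \<Rightarrow> 'a) \<Rightarrow>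
   'k topology \<Rightarrow> ('g \<Rightarrow> 'k \<Rightarrow> 'k) \<Rightarrow> ('a \<Rightarrow> 'k) \<Rightarrow> bool" where
  "equivariant_compactification G \<tau> X act K actK \<nu> \<longleftrightarrow>
     G_space G \<tau> X act \<and> G_space G \<tau> K actK \<and> compactification X K \<nu> \<and>
     (\<forall>g\<in>carrier G. \<forall>x\<in>topspace X. \<nu> (act g x) = actK g (\<nu> x))"

text \<open>A definition cannot quantify over the type of the points of \<open>K'\<close>. The type
  \<open>('a \<Rightarrow> real) \<Rightarrow> real\<close> is large enough to contain a copy of every equivariant compactification of a
  space on \<open>'a\<close>; that nothing is lost is the lemma \<open>maximal_equivariant_compactification_any_type\<close>
  below.\<close>

definition maximal_equivariant_compactification ::
  "('g, 'm) monoid_scheme \<Rightarrow> 'g topology \<Rightarrow> 'a topology \<Rightarrow> ('g \<Rightarrow> 'a \<Rightarrow> 'a) \<Rightarrow>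
   'k topology \<Rightarrow> ('g \<Rightarrow> 'k \<Rightarrow> 'k) \<Rightarrow> ('a \<Rightarrow> 'k) \<Rightarrow> bool" where
  "maximal_equivariant_compactification G \<tau> X act K actK \<nu> \<longleftrightarrow>
     equivariant_compactification G \<tau> X act K actK \<nu> \<and>
     (\<forall>(K' :: (('a \<Rightarrow> real) \<Rightarrow> real) topology) actK' \<nu>'.
        equivariant_compactification G \<tau> X act K' actK' \<nu>' \<longrightarrow>
        compactification_factor X K' \<nu>' K \<nu>)"

text \<open>Real functions on \<open>X\<close> are represented by functions that are extensional on the points of \<open>X\<close>, so
  that two of them are equal iff they agree on \<open>X\<close>.\<close>

definition bounded_continuous_functions :: "'a topology \<Rightarrow> ('a \<Rightarrow> real) set" where
  "bounded_continuous_functions X =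
     {f \<in> extensional (topspace X). continuous_map X euclideanreal f \<and> bounded (f ` topspace X)}"

definition closed_unital_subalgebra :: "'a topology \<Rightarrow> ('a \<Rightarrow> real) set \<Rightarrow> bool" where
  "closed_unital_subalgebra X A \<longleftrightarrow>
     A \<subseteq> bounded_continuous_functions X \<and>
     (\<lambda>x\<in>topspace X. 1) \<in> A \<and>
     (\<forall>f\<in>A. \<forall>g\<in>A. (\<lambda>x\<in>topspace X. f x + g x) \<in> A \<and> (\<lambda>x\<in>topspace X. f x * g x) \<in> A) \<and>
     (\<forall>c. \<forall>f\<in>A. (\<lambda>x\<in>topspace X. c * f x) \<in> A) \<and>
     (\<forall>f\<in>bounded_continuous_functions X.
        (\<forall>e>0. \<exists>g\<in>A. \<forall>x\<in>topspace X. \<bar>f x - g x\<bar> < e) \<longrightarrow> f \<in> A)"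

text \<open>\<open>(K, \<nu>)\<close> corresponds to the algebra \<open>A\<close> if \<open>A\<close> consists of the functions \<open>f \<circ> \<nu>\<close> with \<open>f\<close>
  continuous on \<open>K\<close>. This determines \<open>(K, \<nu>)\<close> up to equivalence.\<close>

definition corresponds_to_algebra ::
  "'a topology \<Rightarrow> ('a \<Rightarrow> real) set \<Rightarrow> 'k topology \<Rightarrow> ('a \<Rightarrow> 'k) \<Rightarrow> bool" where
  "corresponds_to_algebra X A K \<nu> \<longleftrightarrow>
     compactification X K \<nu> \<and>
     {restrict (f \<circ> \<nu>) (topspace X) | f. continuous_map K euclideanreal f} = A"

definition gromov_algebra :: "'a set \<Rightarrow> ('a \<Rightarrow> 'a \<Rightarrow> real) \<Rightarrow> ('a \<Rightarrow> real) set" where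
  "gromov_algebra M d =
     closed_unital_subalgebra (Metric_space.mtopology M d) hull {(\<lambda>x\<in>M. d x z) | z. z \<in> M}"

definition gromov_compactification ::
  "'a set \<Rightarrow> ('a \<Rightarrow> 'a \<Rightarrow> real) \<Rightarrow> 'k topology \<Rightarrow> ('a \<Rightarrow> 'k) \<Rightarrow> bool" where
  "gromov_compactification M d K \<nu> \<longleftrightarrow>
     Metric_space M d \<and> Metric_space.mbounded M d M \<and>
     corresponds_to_algebra (Metric_space.mtopology M d) (gromov_algebra M d) K \<nu>"


section \<open>The space \<open>L\<^sup>p[0,1]\<close>\<close>

abbreviation unit_interval_measure :: "real measure" where
  "unit_interval_measure \<equiv> lebesgue_on {0..1}"

text \<open>The type \<open>L0\<close> of all Lebesgue measurable real functions on \<open>[0,1]\<close> modulo equality almost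
  everywhere. The spaces \<open>L\<^sup>p[0,1]\<close> are subspaces of it.\<close>

quotient_type L0 = "real \<Rightarrow> real" / partial: "\<lambda>f g.
    f \<in> borel_measurable unit_interval_measure \<and> g \<in> borel_measurable unit_interval_measure \<and>
    (AE t in unit_interval_measure. f t = g t)"
proof (rule part_equivpI)
  show "\<exists>f::real \<Rightarrow> real. f \<in> borel_measurable unit_interval_measure \<and>
     f \<in> borel_measurable unit_interval_measure \<and> (AE t in unit_interval_measure. f t = f t)"
    by (rule exI[of _ "\<lambda>_. 0"]) simp
next
  show "symp (\<lambda>f g::real \<Rightarrow> real. f \<in> borel_measurable unit_interval_measure \<and>
     g \<in> borel_measurable unit_interval_measure \<and> (AE t in unit_interval_measure. f t = g t))"
    by (rule sympI) (auto simp: eq_commute)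
next
  show "transp (\<lambda>f g::real \<Rightarrow> real. f \<in> borel_measurable unit_interval_measure \<and>
     g \<in> borel_measurable unit_interval_measure \<and> (AE t in unit_interval_measure. f t = g t))"
    by (rule transpI) (auto elim: AE_mp)
qed

instantiation L0 :: real_vector
begin

lift_definition zero_L0 :: L0 is "\<lambda>_. 0" by simp

lift_definition plus_L0 :: "L0 \<Rightarrow> L0 \<Rightarrow> L0" is "\<lambda>f g t. f t + g t" by (auto elim: AE_mp)

lift_definition minus_L0 :: "L0 \<Rightarrow> L0 \<Rightarrow> L0" is "\<lambda>f g t. f t - g t" by (auto elim: AE_mp)

lift_definition uminus_L0 :: "L0 \<Rightarrow> L0" is "\<lambda>f t. - f t" by (auto elim: AE_mp)

lift_definition scaleR_L0 :: "real \<Rightarrow> L0 \<Rightarrow> L0" is "\<lambda>c f t. c * f t" by (auto elim: AE_mp)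

instance
  by standard (transfer; auto simp: algebra_simps)+

end

lift_definition Lp_integrable :: "real \<Rightarrow> L0 \<Rightarrow> bool" is
  "\<lambda>p f. integrable unit_interval_measure (\<lambda>t. \<bar>f t\<bar> powr p)"
  by (rule integrable_cong_AE) (auto elim: AE_mp)

lift_definition Lp_norm :: "real \<Rightarrow> L0 \<Rightarrow> real" is
  "\<lambda>p f. (\<integral>t. \<bar>f t\<bar> powr p \<partial>unit_interval_measure) powr (1 / p)"
  by (rule arg_cong[where f = "\<lambda>u. u powr _"], rule integral_cong_AE) (auto elim: AE_mp)

definition Lp :: "real \<Rightarrow> L0 set" where
  "Lp p = {x. Lp_integrable p x}"

definition Lp_dist :: "real \<Rightarrow> L0 \<Rightarrow> L0 \<Rightarrow> real" where
  "Lp_dist p x y = Lp_norm p (x - y)"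

definition Lp_dual :: "real \<Rightarrow> (L0 \<Rightarrow> real) set" where
  "Lp_dual p = {\<phi>. (\<forall>x\<in>Lp p. \<forall>y\<in>Lp p. \<phi> (x + y) = \<phi> x + \<phi> y) \<and>
                   (\<forall>c. \<forall>x\<in>Lp p. \<phi> (c *\<^sub>R x) = c * \<phi> x) \<and>
                   (\<exists>C. \<forall>x\<in>Lp p. \<bar>\<phi> x\<bar> \<le> C * Lp_norm p x)}"

definition Lp_weak_topology :: "real \<Rightarrow> L0 topology" where
  "Lp_weak_topology p =
     topology_generated_by {{x \<in> Lp p. \<phi> x \<in> U} | \<phi> U. \<phi> \<in> Lp_dual p \<and> open U}"

definition Lp_sphere :: "real \<Rightarrow> L0 set" where
  "Lp_sphere p = {x \<in> Lp p. Lp_norm p x = 1}"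

definition Lp_sphere_topology :: "real \<Rightarrow> L0 topology" where
  "Lp_sphere_topology p = Metric_space.mtopology (Lp_sphere p) (Lp_dist p)"

definition Lp_weak_ball :: "real \<Rightarrow> L0 topology" where
  "Lp_weak_ball p = subtopology (Lp_weak_topology p) {x \<in> Lp p. Lp_norm p x \<le> 1}"

text \<open>Operators on \<open>L\<^sup>p[0,1]\<close> are functions that are extensional on \<open>Lp p\<close>, so that distinct group
  elements are distinct operators.\<close>

definition Lp_isometries :: "real \<Rightarrow> (L0 \<Rightarrow> L0) set" where
  "Lp_isometries p = {T \<in> extensional (Lp p). T ` Lp p = Lp p \<and>
     (\<forall>x\<in>Lp p. \<forall>y\<in>Lp p. T (x + y) = T x + T y) \<and>
     (\<forall>c. \<forall>x\<in>Lp p. T (c *\<^sub>R x) = c *\<^sub>R T x) \<and>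
     (\<forall>x\<in>Lp p. Lp_norm p (T x) = Lp_norm p x)}"

definition Lp_isometry_group :: "real \<Rightarrow> (L0 \<Rightarrow> L0) monoid" where
  "Lp_isometry_group p =
     \<lparr>carrier = Lp_isometries p, mult = (\<lambda>S T. compose (Lp p) S T), one = (\<lambda>x\<in>Lp p. x)\<rparr>"

text \<open>The strong operator topology is the topology of pointwise norm convergence.\<close>

definition Lp_strong_operator_topology :: "real \<Rightarrow> (L0 \<Rightarrow> L0) topology" where
  "Lp_strong_operator_topology p =
     subtopology (product_topology (\<lambda>_. Metric_space.mtopology (Lp p) (Lp_dist p)) (Lp p))
       (Lp_isometries p)"


section \<open>Adequacy of the definitions\<close>

text \<open>Maximality with respect to compactifications on the type \<open>('a \<Rightarrow> real) \<Rightarrow> real\<close> implies maximality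
  with respect to compactifications on any type.\<close>

lemma maximal_equivariant_compactification_any_type:
  fixes X :: "'a topology" and K' :: "'l topology"
  assumes max: "maximal_equivariant_compactification G \<tau> X act K actK \<nu>"
    and eq: "equivariant_compactification G \<tau> X act K' actK' \<nu>'"
  shows "compactification_factor X K' \<nu>' K \<nu>"
proof -
  define C where "C = {restrict (f \<circ> \<nu>') (topspace X) | f. continuous_map K' euclideanreal f}"
  have GK: "G_space G \<tau> K' actK'" and GX: "G_space G \<tau> X act" and comp: "compactification X K' \<nu>'"
    and equi: "\<And>g x. g \<in> carrier G \<Longrightarrow> x \<in> topspace X \<Longrightarrow> \<nu>' (act g x) = actK' g (\<nu>' x)"
    using eq unfolding equivariant_compactification_def by auto
  have cpt: "compact_space K'" and haus: "Hausdorff_space K'" and cont: "continuous_map X K' \<nu>'"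
    and dense: "K' closure_of (\<nu>' ` topspace X) = topspace K'"
    using comp unfolding compactification_def by auto
  have "\<forall>h\<in>C. \<exists>f. continuous_map K' euclideanreal f \<and> h = restrict (f \<circ> \<nu>') (topspace X)"
    unfolding C_def by auto
  then obtain E where E: "\<And>h. h \<in> C \<Longrightarrow> continuous_map K' euclideanreal (E h)"
      "\<And>h. h \<in> C \<Longrightarrow> h = restrict (E h \<circ> \<nu>') (topspace X)"
    by metis
  define e where "e k = (\<lambda>h\<in>C. E h k)" for k
  define P where "P = subtopology (product_topology (\<lambda>_. euclideanreal) C) (e ` topspace K')"
  have top_P: "topspace P = e ` topspace K'"
    unfolding P_def e_def by (auto simp: topspace_product_topology)
  have cont_e: "continuous_map K' P e"
    unfolding P_def continuous_map_in_subtopology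
    by (auto simp: continuous_map_componentwise e_def E)
  have haus_P: "Hausdorff_space P"
    unfolding P_def by (simp add: Hausdorff_space_subtopology Hausdorff_space_product_topology)
  have inj: "inj_on e (topspace K')"
  proof (rule inj_onI, rule ccontr)
    fix k l assume kl: "k \<in> topspace K'" "l \<in> topspace K'" "e k = e l" "k \<noteq> l"
    have "completely_regular_space K'" 
      using GK unfolding G_space_def tychonoff_space_def by blast
    moreover have "closedin K' {l}"
      using haus kl(2) by (simp add: closedin_Hausdorff_sing_eq)
    ultimately obtain f where f: "continuous_map K' euclideanreal f" "f k = 0" "f ` {l} \<subseteq> {1}"
      unfolding completely_regular_space_alt using kl by blast
    define h where "h = restrict (f \<circ> \<nu>') (topspace X)"
    have h: "h \<in> C" unfolding h_def C_def using f(1) by blast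
    have "E h u = f u" if "u \<in> topspace K'" for u
    proof (rule forall_in_closure_of_eq[of u K' "\<nu>' ` topspace X" euclideanreal])
      show "u \<in> K' closure_of \<nu>' ` topspace X" using that dense by simp
      fix v assume "v \<in> \<nu>' ` topspace X"
      then obtain x where x: "x \<in> topspace X" "v = \<nu>' x" by blast
      have "restrict (E h \<circ> \<nu>') (topspace X) x = restrict (f \<circ> \<nu>') (topspace X) x"
        using E(2)[OF h] h_def by metis
      then show "E h v = f v" using x by simp
    qed (use E(1)[OF h] f(1) in auto)
    moreover have "E h k = E h l" using fun_cong[OF kl(3), of h] h by (simp add: e_def)
    ultimately show False using f kl by auto
  qed
  have hom: "homeomorphic_map K' P e"
    by (rule continuous_imp_homeomorphic_map[OF cont_e cpt haus_P top_P[symmetric] inj])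
  then obtain r where r: "homeomorphic_maps K' P e r"
    by (auto simp: homeomorphic_map_maps)
  have re: "\<And>k. k \<in> topspace K' \<Longrightarrow> r (e k) = k" and er: "\<And>u. u \<in> topspace P \<Longrightarrow> e (r u) = u"
    and cont_r: "continuous_map P K' r"
    using r unfolding homeomorphic_maps_def by auto
  have hs: "K' homeomorphic_space P" using r unfolding homeomorphic_space_def by blast
  define aP where "aP g u = e (actK' g (r u))" for g u
  have act_in: "actK' g k \<in> topspace K'" if "g \<in> carrier G" "k \<in> topspace K'" for g k
  proof -
    have "continuous_map (prod_topology \<tau> K') K' (\<lambda>(g, k). actK' g k)" "topspace \<tau> = carrier G"
      using GK unfolding G_space_def topological_group_def by auto
    note this(1)[THEN continuous_map_image_subset_topspace, THEN subsetD] this(2)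
    from this(1)[OF imageI, of "(g, k)"] this(2) show ?thesis using that by simp
  qed
  have r_in: "r u \<in> topspace K'" if "u \<in> topspace P" for u
    using that cont_r by (auto simp: continuous_map_def)
  have nu_in: "\<nu>' x \<in> topspace K'" if "x \<in> topspace X" for x
    using that cont by (auto simp: continuous_map_def)
  have "G_space G \<tau> P aP"
    unfolding G_space_def
  proof (intro conjI ballI)
    show tg: "topological_group G \<tau>" using GK by (simp add: G_space_def)
    then interpret group G by (simp add: topological_group_def)
    show "tychonoff_space P"
      using GK hs homeomorphic_completely_regular_space haus_P
      unfolding G_space_def tychonoff_space_def by blast
    have c1: "continuous_map (prod_topology \<tau> P) (prod_topology \<tau> K') (\<lambda>z. (fst z, r (snd z)))"
      unfolding continuous_map_pairwise
      using continuous_map_fst continuous_map_compose[OF continuous_map_snd cont_r]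
      by (auto simp: o_def)
    have c2: "continuous_map (prod_topology \<tau> K') K' (\<lambda>(g, k). actK' g k)"
      using GK by (simp add: G_space_def)
    show "continuous_map (prod_topology \<tau> P) P (\<lambda>(g, u). aP g u)"
      using continuous_map_compose[OF continuous_map_compose[OF c1 c2] cont_e]
      by (simp add: o_def aP_def case_prod_unfold)
    fix u assume u: "u \<in> topspace P"
    show "aP \<one>\<^bsub>G\<^esub> u = u"
      using GK u r_in er unfolding aP_def G_space_def by auto
    fix g h assume gh: "g \<in> carrier G" "h \<in> carrier G"
    have "actK' (g \<otimes>\<^bsub>G\<^esub> h) (r u) = actK' g (actK' h (r u))"
      using GK gh r_in[OF u] unfolding G_space_def by blast
    then show "aP (g \<otimes>\<^bsub>G\<^esub> h) u = aP g (aP h u)"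
      unfolding aP_def using re act_in gh r_in[OF u] by simp
  qed
  moreover have "compactification X P (e \<circ> \<nu>')"
    unfolding compactification_def
  proof (intro conjI)
    show "compact_space P" using cpt hs homeomorphic_compact_space by blast
    show "continuous_map X P (e \<circ> \<nu>')" by (rule continuous_map_compose[OF cont cont_e])
    show "P closure_of (e \<circ> \<nu>') ` topspace X = topspace P"
      using homeomorphic_map_closure_of[OF hom, of "\<nu>' ` topspace X"] nu_in dense top_P
      by (auto simp: image_comp)
  qed (rule haus_P)
  ultimately have "equivariant_compactification G \<tau> X act P aP (e \<circ> \<nu>')"
    unfolding equivariant_compactification_def using GX equi re nu_in by (auto simp: aP_def)
  then have "compactification_factor X P (e \<circ> \<nu>') K \<nu>"
    using max unfolding maximal_equivariant_compactification_def by blast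
  then obtain \<pi> where "continuous_map K P \<pi>" "\<And>x. x \<in> topspace X \<Longrightarrow> \<pi> (\<nu> x) = e (\<nu>' x)"
    unfolding compactification_factor_def by auto
  then show ?thesis
    unfolding compactification_factor_def using continuous_map_compose[OF _ cont_r] re nu_in
    by (intro exI[of _ "r \<circ> \<pi>"]) auto
qed

text \<open>Every closed unital subalgebra has a corresponding compactification; in particular a bounded
  metric space has a Gromov compactification, and \<open>Lp_sphere p\<close> is such a space.\<close>

text \<open>A copy of the function type with the product topology. It is only needed because
  \<open>Stone_Weierstrass_HOL\<close> asks for the class \<open>t2_space\<close>, of which the function type is not a
  general instance.\<close>

typedef 'i real_cube = "UNIV :: ('i \<Rightarrow> real) set" ..

instantiation real_cube :: (type) t2_space
begin

definition open_real_cube :: "'a real_cube set \<Rightarrow> bool" where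
  "open_real_cube U \<longleftrightarrow> open (Abs_real_cube -` U)"

instance
proof
  show "open (UNIV :: 'a real_cube set)" by (simp add: open_real_cube_def)
  show "open (U \<inter> V)" if "open U" "open V" for U V :: "'a real_cube set"
    using that by (simp add: open_real_cube_def open_Int)
  show "open (\<Union>\<U>)" if "\<forall>U\<in>\<U>. open U" for \<U> :: "'a real_cube set set"
    using that by (auto simp: open_real_cube_def vimage_Union)
  fix x y :: "'a real_cube" assume "x \<noteq> y"
  then obtain i where i: "Rep_real_cube x i \<noteq> Rep_real_cube y i"
    by (metis Rep_real_cube_inject ext)
  then obtain U V where UV: "open U" "open V" "Rep_real_cube x i \<in> U" "Rep_real_cube y i \<in> V"
    "U \<inter> V = {}"
    using hausdorff[OF i] by blast
  have W: "open {z. Rep_real_cube z i \<in> W}" if "open W" for W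
  proof -
    have "open ((\<lambda>z::'a \<Rightarrow> real. z i) -` W)"
      using open_vimage[OF that, of "\<lambda>z::'a \<Rightarrow> real. z i"] by simp
    then show ?thesis
      by (simp add: open_real_cube_def vimage_def Abs_real_cube_inverse)
  qed
  show "\<exists>U V. open U \<and> open V \<and> x \<in> U \<and> y \<in> V \<and> U \<inter> V = {}"
    by (rule exI[of _ "{z. Rep_real_cube z i \<in> U}"], rule exI[of _ "{z. Rep_real_cube z i \<in> V}"])
       (use W[OF UV(1)] W[OF UV(2)] UV(3-5) in blast)
qed

end

lemma continuous_on_Abs_real_cube: "continuous_on UNIV Abs_real_cube"
  by (rule continuous_on_open_vimage[THEN iffD2, rule_format, OF open_UNIV])
     (simp add: open_real_cube_def)

lemma continuous_on_Rep_real_cube: "continuous_on UNIV Rep_real_cube"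
  by (rule continuous_on_open_vimage[THEN iffD2, rule_format, OF open_UNIV])
     (simp add: open_real_cube_def vimage_def Abs_real_cube_inverse)

lemma Stone_Weierstrass_fun:
  fixes S :: "('i \<Rightarrow> real) set"
  assumes S: "compact S" and const: "\<And>c. P (\<lambda>x. c)" and cont: "\<And>f. P f \<Longrightarrow> continuous_on S f"
    and add: "\<And>f g. P f \<and> P g \<Longrightarrow> P (\<lambda>x. f x + g x)"
    and mult: "\<And>f g. P f \<and> P g \<Longrightarrow> P (\<lambda>x. f x * g x)"
    and sep: "\<And>x y. x \<in> S \<and> y \<in> S \<and> x \<noteq> y \<Longrightarrow> \<exists>f. P f \<and> f x \<noteq> f y"
    and f: "continuous_on S f" and e: "0 < (e::real)"
  shows "\<exists>g. P g \<and> (\<forall>x\<in>S. \<bar>f x - g x\<bar> < e)"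
proof -
  let ?S = "Abs_real_cube ` S"
  have RA: "Rep_real_cube (Abs_real_cube x) = x" and AR: "Abs_real_cube (Rep_real_cube z) = z"
    for x :: "'i \<Rightarrow> real" and z
    by (simp_all add: Abs_real_cube_inverse Rep_real_cube_inverse)
  have lift: "continuous_on ?S (\<lambda>z. g (Rep_real_cube z))" if "continuous_on S g" for g :: "_ \<Rightarrow> real"
    by (rule continuous_on_compose2[OF that continuous_on_subset[OF continuous_on_Rep_real_cube]])
       (auto simp: RA)
  have "\<exists>g. P (\<lambda>x. g (Abs_real_cube x)) \<and> (\<forall>z\<in>?S. \<bar>f (Rep_real_cube z) - g z\<bar> < e)"
  proof (rule Stone_Weierstrass_HOL)
    show "compact ?S"
      by (rule compact_continuous_image[OF continuous_on_subset[OF continuous_on_Abs_real_cube] S]) simp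
    show "continuous_on ?S g" if "P (\<lambda>x. g (Abs_real_cube x))" for g
      using lift[OF cont[OF that]] by (simp add: AR)
    show "\<exists>g. P (\<lambda>x. g (Abs_real_cube x)) \<and> g x \<noteq> g y" if "x \<in> ?S \<and> y \<in> ?S \<and> x \<noteq> y" for x y
    proof -
      have "\<exists>g. P g \<and> g (Rep_real_cube x) \<noteq> g (Rep_real_cube y)"
      proof -
        have "Rep_real_cube x \<in> S" "Rep_real_cube y \<in> S" "Rep_real_cube x \<noteq> Rep_real_cube y"
          using that by (auto simp: RA Rep_real_cube_inject)
        then show ?thesis using sep by blast
      qed
      then obtain g where "P g" "g (Rep_real_cube x) \<noteq> g (Rep_real_cube y)" by blast
      then show ?thesis by (intro exI[of _ "\<lambda>z. g (Rep_real_cube z)"]) (simp add: RA)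
    qed
  qed (use const add mult lift[OF f] e in auto)
  then show ?thesis by (auto simp: RA)
qed

lemma ex_corresponds_to_algebra:
  fixes X :: "'a topology"
  assumes A: "closed_unital_subalgebra X A"
  shows "\<exists>(K :: (('a \<Rightarrow> real) \<Rightarrow> real) topology) \<nu>. corresponds_to_algebra X A K \<nu>"
proof -
  define \<nu> where "\<nu> x = (\<lambda>f. if f \<in> A then f x else 0)" for x :: 'a
  define S where "S = closure (\<nu> ` topspace X)"
  define K where "K = top_of_set S"
  have AC: "f \<in> extensional (topspace X)" "continuous_map X euclideanreal f"
      "bounded (f ` topspace X)" if "f \<in> A" for f
    using A that unfolding closed_unital_subalgebra_def bounded_continuous_functions_def by auto
  have one: "(\<lambda>x\<in>topspace X. 1) \<in> A" 
    and add: "\<And>f g. f \<in> A \<Longrightarrow> g \<in> A \<Longrightarrow> (\<lambda>x\<in>topspace X. f x + g x) \<in> A"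
    and mul: "\<And>f g. f \<in> A \<Longrightarrow> g \<in> A \<Longrightarrow> (\<lambda>x\<in>topspace X. f x * g x) \<in> A"
    and scal: "\<And>c f. f \<in> A \<Longrightarrow> (\<lambda>x\<in>topspace X. c * f x) \<in> A"
    and clo: "\<And>f. f \<in> bounded_continuous_functions X \<Longrightarrow>
        (\<And>e. e > 0 \<Longrightarrow> \<exists>g\<in>A. \<forall>x\<in>topspace X. \<bar>f x - g x\<bar> < e) \<Longrightarrow> f \<in> A"
    using A unfolding closed_unital_subalgebra_def by blast+
  have const: "(\<lambda>x\<in>topspace X. c) \<in> A" for c
    using scal[OF one, of c] by (simp cong: restrict_cong)
  have "\<forall>f\<in>A. \<exists>b. \<forall>x\<in>topspace X. \<bar>f x\<bar> \<le> b"
    using AC(3) unfolding bounded_iff by auto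
  then obtain b where b: "\<And>f x. f \<in> A \<Longrightarrow> x \<in> topspace X \<Longrightarrow> \<bar>f x\<bar> \<le> b f"
    by metis
  define Q where "Q = (\<Pi>\<^sub>E f\<in>UNIV. if f \<in> A then {- b f..b f} else {0::real})"
  have "compactin (product_topology (\<lambda>_. euclideanreal) UNIV) Q"
    unfolding Q_def by (subst compactin_PiE) auto
  then have cQ: "compact Q" by (simp add: euclidean_product_topology)
  have "closed {z::('a \<Rightarrow> real) \<Rightarrow> real. z k \<in> (if k \<in> A then {- b k..b k} else {0})}" for k
    by (rule closed_vimage[OF _ continuous_on_product_coordinates, unfolded vimage_def]) simp
  then have "closed (\<Inter>k. {z. z k \<in> (if k \<in> A then {- b k..b k} else {0})})" by blast
  then have clQ: "closed Q" unfolding Q_def by (simp add: PiE_UNIV_domain Pi_def INTER_eq)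
  have sub: "\<nu> ` topspace X \<subseteq> Q"
    unfolding Q_def \<nu>_def using b by (force simp: PiE_iff abs_le_iff)
  have SQ: "S \<subseteq> Q"
    unfolding S_def by (rule closure_minimal[OF sub clQ])
  have cS: "compact S"
    using cQ SQ by (metis S_def closed_closure compact_Int_closed inf.absorb_iff2)
  have cont0: "continuous_map X euclidean \<nu>"
    unfolding euclidean_product_topology[symmetric] continuous_map_componentwise_UNIV
    using AC(2) by (auto simp: \<nu>_def)
  have nuS: "\<nu> x \<in> S" if "x \<in> topspace X" for x
    unfolding S_def by (rule subsetD[OF closure_subset]) (rule imageI[OF that])
  have cont: "continuous_map X K \<nu>"
    unfolding K_def continuous_map_in_subtopology using cont0 nuS by auto
  have "compactification X K \<nu>"
    unfolding compactification_def
  proof (intro conjI cont)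
    show "compact_space K" unfolding K_def using cS by (simp add: compact_space_subtopology)
    show "Hausdorff_space K" unfolding K_def euclidean_product_topology[symmetric]
      by (simp add: Hausdorff_space_subtopology Hausdorff_space_product_topology)
    have "\<nu> ` topspace X \<subseteq> S" using nuS by blast
    then show "K closure_of \<nu> ` topspace X = topspace K"
      unfolding K_def by (simp add: closure_of_subtopology Int_absorb1 S_def)
  qed
  moreover have "{restrict (f \<circ> \<nu>) (topspace X) | f. continuous_map K euclideanreal f} = A"
  proof (intro equalityI subsetI)
    fix h assume h: "h \<in> A"
    have "continuous_map K euclideanreal (\<lambda>u. u h)"
      unfolding K_def by (auto intro: continuous_on_subset[OF continuous_on_product_coordinates])
    moreover have "h = restrict ((\<lambda>u. u h) \<circ> \<nu>) (topspace X)"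
      using AC(1)[OF h] h by (auto simp: \<nu>_def fun_eq_iff extensional_def)
    ultimately show "h \<in> {restrict (f \<circ> \<nu>) (topspace X) | f. continuous_map K euclideanreal f}"
      by blast
  next
    fix h assume "h \<in> {restrict (f \<circ> \<nu>) (topspace X) | f. continuous_map K euclideanreal f}"
    then obtain f where f: "continuous_map K euclideanreal f" "h = restrict (f \<circ> \<nu>) (topspace X)"
      by blast
    have fS: "continuous_on S f" using f(1) unfolding K_def by simp
    define R where "R F \<longleftrightarrow> continuous_on S F \<and> restrict (F \<circ> \<nu>) (topspace X) \<in> A" for F
    have SW: "\<exists>g. R g \<and> (\<forall>x\<in>S. \<bar>f x - g x\<bar> < e)" if "e > 0" for e
    proof (rule Stone_Weierstrass_fun[OF cS _ _ _ _ _ fS that])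
      show "R (\<lambda>x. c)" for c using const[of c] by (simp add: R_def o_def)
      show "R F \<Longrightarrow> continuous_on S F" for F by (simp add: R_def)
      show "R F \<and> R F' \<Longrightarrow> R (\<lambda>x. F x + F' x)" for F F'
        using add[of "restrict (F \<circ> \<nu>) (topspace X)" "restrict (F' \<circ> \<nu>) (topspace X)"]
        by (auto simp: R_def o_def intro!: continuous_intros cong: restrict_cong)
      show "R F \<and> R F' \<Longrightarrow> R (\<lambda>x. F x * F' x)" for F F'
        using mul[of "restrict (F \<circ> \<nu>) (topspace X)" "restrict (F' \<circ> \<nu>) (topspace X)"]
        by (auto simp: R_def o_def intro!: continuous_intros cong: restrict_cong)
      fix u v assume uv: "u \<in> S \<and> v \<in> S \<and> u \<noteq> v"
      then obtain k where k: "u k \<noteq> v k" by auto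
      have kA: "k \<in> A"
      proof (rule ccontr)
        assume "k \<notin> A"
        moreover have "w k \<in> (if k \<in> A then {- b k..b k} else {0})" if "w \<in> S" for w
          using subsetD[OF SQ that] unfolding Q_def by (rule PiE_mem) simp
        ultimately have "u k = 0" "v k = 0" using uv by force+
        then show False using k by simp
      qed
      have "R (\<lambda>u. u k)"
      proof -
        have "restrict ((\<lambda>u. u k) \<circ> \<nu>) (topspace X) = k"
          using AC(1)[OF kA] kA by (auto simp: \<nu>_def fun_eq_iff extensional_def)
        then show ?thesis using kA unfolding R_def
          by (auto intro: continuous_on_subset[OF continuous_on_product_coordinates])
      qed
      then show "\<exists>F. R F \<and> F u \<noteq> F v" using k by blast
    qed
    show "h \<in> A"
    proof (rule clo)
      have "continuous_map X euclideanreal h"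
        using continuous_map_compose[OF cont f(1)] unfolding f(2)
        by (rule continuous_map_eq) auto
      moreover have "bounded (f ` S)"
        using compact_continuous_image[OF fS cS] compact_imp_bounded by blast
      then have "bounded (h ` topspace X)"
        by (rule bounded_subset) (use nuS f(2) in auto)
      ultimately show "h \<in> bounded_continuous_functions X"
        unfolding bounded_continuous_functions_def using f(2) by simp
      fix e :: real assume "e > 0"
      then obtain g where g: "R g" "\<forall>x\<in>S. \<bar>f x - g x\<bar> < e" using SW by blast
      then show "\<exists>g\<in>A. \<forall>x\<in>topspace X. \<bar>h x - g x\<bar> < e"
        using nuS f(2) by (intro bexI[of _ "restrict (g \<circ> \<nu>) (topspace X)"]) (auto simp: R_def)
    qed
  qed
  ultimately show ?thesis unfolding corresponds_to_algebra_def by blast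
qed

lemma closed_unital_subalgebra_bounded_continuous_functions:
  "closed_unital_subalgebra X (bounded_continuous_functions X)"
proof -
  let ?B = "bounded_continuous_functions X"
  have mem: "restrict f (topspace X) \<in> ?B"
    if c: "continuous_map X euclideanreal f" and b: "\<And>x. x \<in> topspace X \<Longrightarrow> \<bar>f x\<bar> \<le> a" for f a
  proof -
    have "continuous_map X euclideanreal (restrict f (topspace X))"
      using c by (rule continuous_map_eq) simp
    moreover have "bounded (restrict f (topspace X) ` topspace X)"
      unfolding bounded_iff using b by (intro exI[of _ a]) simp
    ultimately show ?thesis by (simp add: bounded_continuous_functions_def)
  qed
  have memD: "continuous_map X euclideanreal f \<and> (\<exists>a. \<forall>x\<in>topspace X. \<bar>f x\<bar> \<le> a)" if "f \<in> ?B" for f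
    using that by (auto simp: bounded_continuous_functions_def bounded_iff)
  show ?thesis
    unfolding closed_unital_subalgebra_def
  proof (intro conjI ballI allI impI)
    show "(\<lambda>x\<in>topspace X. 1) \<in> ?B" by (rule mem[of _ 1]) auto
  next
    fix f g assume "f \<in> ?B" "g \<in> ?B"
    then obtain a b where f: "continuous_map X euclideanreal f" "\<And>x. x \<in> topspace X \<Longrightarrow> \<bar>f x\<bar> \<le> a"
      and g: "continuous_map X euclideanreal g" "\<And>x. x \<in> topspace X \<Longrightarrow> \<bar>g x\<bar> \<le> b"
      using memD by meson
    show "(\<lambda>x\<in>topspace X. f x + g x) \<in> ?B"
    proof (rule mem[of _ "a + b"])
      show "\<bar>f x + g x\<bar> \<le> a + b" if "x \<in> topspace X" for x
        using f(2)[OF that] g(2)[OF that] by linarith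
    qed (rule continuous_map_add[OF f(1) g(1)])
    show "(\<lambda>x\<in>topspace X. f x * g x) \<in> ?B"
    proof (rule mem[of _ "a * b"])
      show "\<bar>f x * g x\<bar> \<le> a * b" if "x \<in> topspace X" for x
        using mult_mono[OF f(2)[OF that] g(2)[OF that]] f(2)[OF that] by (simp add: abs_mult)
    qed (rule continuous_map_real_mult[OF f(1) g(1)])
  next
    fix c f assume "f \<in> ?B"
    then obtain a where f: "continuous_map X euclideanreal f" "\<And>x. x \<in> topspace X \<Longrightarrow> \<bar>f x\<bar> \<le> a"
      using memD by meson
    show "(\<lambda>x\<in>topspace X. c * f x) \<in> ?B"
    proof (rule mem[of _ "\<bar>c\<bar> * a"])
      show "\<bar>c * f x\<bar> \<le> \<bar>c\<bar> * a" if "x \<in> topspace X" for x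
        using f(2)[OF that] by (simp add: abs_mult mult_left_mono)
    qed (rule continuous_map_real_mult_left[OF f(1)])
  qed auto
qed

lemma closed_unital_subalgebra_Inter:
  assumes ne: "T \<noteq> {}" and T: "\<And>t. t \<in> T \<Longrightarrow> closed_unital_subalgebra X t"
  shows "closed_unital_subalgebra X (\<Inter>T)"
  unfolding closed_unital_subalgebra_def
proof (intro conjI ballI allI impI)
  show "\<Inter>T \<subseteq> bounded_continuous_functions X"
    using ne T unfolding closed_unital_subalgebra_def by blast
  show "(\<lambda>x\<in>topspace X. 1) \<in> \<Inter>T"
    using T unfolding closed_unital_subalgebra_def by blast
next
  fix f g assume fg: "f \<in> \<Inter>T" "g \<in> \<Inter>T"
  have "(\<lambda>x\<in>topspace X. f x + g x) \<in> t \<and> (\<lambda>x\<in>topspace X. f x * g x) \<in> t" if "t \<in> T" for t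
    using T[OF that] InterD[OF fg(1) that] InterD[OF fg(2) that]
    unfolding closed_unital_subalgebra_def by blast
  then show "(\<lambda>x\<in>topspace X. f x + g x) \<in> \<Inter>T" "(\<lambda>x\<in>topspace X. f x * g x) \<in> \<Inter>T"
    by blast+
next
  fix c f assume f: "f \<in> \<Inter>T"
  have "(\<lambda>x\<in>topspace X. c * f x) \<in> t" if "t \<in> T" for t
    using T[OF that] InterD[OF f that] unfolding closed_unital_subalgebra_def by blast
  then show "(\<lambda>x\<in>topspace X. c * f x) \<in> \<Inter>T" by blast
next
  fix f assume f: "f \<in> bounded_continuous_functions X"
    and app: "\<forall>e>0. \<exists>g\<in>\<Inter>T. \<forall>x\<in>topspace X. \<bar>f x - g x\<bar> < e"
  have "f \<in> t" if t: "t \<in> T" for t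
  proof -
    have "\<forall>e>0. \<exists>g\<in>t. \<forall>x\<in>topspace X. \<bar>f x - g x\<bar> < e"
      using app t by (meson InterD)
    then show ?thesis using T[OF t] f unfolding closed_unital_subalgebra_def by blast
  qed
  then show "f \<in> \<Inter>T" by blast
qed

lemma ex_gromov_compactification:
  fixes M :: "'a set"
  assumes "Metric_space M d" "Metric_space.mbounded M d M"
  shows "\<exists>(K :: (('a \<Rightarrow> real) \<Rightarrow> real) topology) \<gamma>. gromov_compactification M d K \<gamma>"
proof -
  interpret Metric_space M d by fact
  let ?Z = "{(\<lambda>x\<in>M. d x z) | z. z \<in> M}"
  obtain B where B: "\<And>x y. x \<in> M \<Longrightarrow> y \<in> M \<Longrightarrow> d x y \<le> B"
    using assms(2) unfolding mbounded_alt by blast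
  have "?Z \<subseteq> bounded_continuous_functions mtopology"
  proof clarify
    fix z assume z: "z \<in> M"
    have "continuous_map mtopology euclideanreal (\<lambda>x. d x z)"
      using continuous_map_mdist[of mtopology "metric (M, d)" "\<lambda>x. x" "\<lambda>_. z"] z by simp
    then have "continuous_map mtopology euclideanreal (\<lambda>x\<in>M. d x z)"
      by (rule continuous_map_eq) simp
    moreover have "bounded ((\<lambda>x\<in>M. d x z) ` M)"
      unfolding bounded_iff using B z by (intro exI[of _ B]) auto
    ultimately show "(\<lambda>x\<in>M. d x z) \<in> bounded_continuous_functions mtopology"
      by (simp add: bounded_continuous_functions_def)
  qed
  then have ne: "bounded_continuous_functions mtopology \<in>
      {t. closed_unital_subalgebra mtopology t \<and> ?Z \<subseteq> t}"
    using closed_unital_subalgebra_bounded_continuous_functions by blast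
  have "closed_unital_subalgebra mtopology (gromov_algebra M d)"
    unfolding gromov_algebra_def hull_def
    by (rule closed_unital_subalgebra_Inter) (use ne in blast)+
  then show ?thesis
    using ex_corresponds_to_algebra[of mtopology "gromov_algebra M d"] assms
    unfolding gromov_compactification_def by blast
qed

lemma powr_convex_nonneg:
  fixes a b s t p :: real
  assumes p: "1 \<le> p" and nn: "0 \<le> a" "0 \<le> b" "0 \<le> s" "0 \<le> t" and st: "s + t = 1"
  shows "(s * a + t * b) powr p \<le> s * a powr p + t * b powr p"
proof -
  have *: "(r * c) powr p \<le> r * c powr p" if "0 \<le> r" "r \<le> 1" "0 \<le> c" for r c :: real
  proof -
    have "r powr p \<le> r powr 1" using that p by (intro powr_mono') auto
    then show ?thesis using that by (simp add: powr_mult mult_right_mono)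
  qed
  consider "a = 0" | "b = 0" | "a > 0" "b > 0" using nn by linarith
  then show ?thesis
  proof cases
    case 1 then show ?thesis using *[of t b] nn st by simp
  next
    case 2 then show ?thesis using *[of s a] nn st by simp
  next
    case 3
    have "s = 1 - t" using st by simp
    moreover have "((1 - t) * a + t * b) powr p \<le> (1 - t) * a powr p + t * b powr p"
      using convex_onD[OF powr_convex[OF p], of t a b] 3 nn st by simp
    ultimately show ?thesis by (simp only:)
  qed
qed

lemma Minkowski_powr:
  fixes f g :: "'a \<Rightarrow> real"
  assumes p: "1 \<le> p" and meas: "f \<in> borel_measurable M" "g \<in> borel_measurable M"
    and f: "integrable M (\<lambda>t. \<bar>f t\<bar> powr p)" and g: "integrable M (\<lambda>t. \<bar>g t\<bar> powr p)"
  shows "integrable M (\<lambda>t. \<bar>f t + g t\<bar> powr p)"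
    and "(\<integral>t. \<bar>f t + g t\<bar> powr p \<partial>M) powr (1 / p) \<le>
         (\<integral>t. \<bar>f t\<bar> powr p \<partial>M) powr (1 / p) + (\<integral>t. \<bar>g t\<bar> powr p \<partial>M) powr (1 / p)"
proof -
  define A where "A = (\<integral>t. \<bar>f t\<bar> powr p \<partial>M) powr (1 / p)"
  define B where "B = (\<integral>t. \<bar>g t\<bar> powr p \<partial>M) powr (1 / p)"
  have A: "A \<ge> 0" "A powr p = (\<integral>t. \<bar>f t\<bar> powr p \<partial>M)" and B: "B \<ge> 0" "B powr p = (\<integral>t. \<bar>g t\<bar> powr p \<partial>M)"
    using p by (simp_all add: A_def B_def powr_powr)
  define C where "C a b t = (a + b) powr p * (a / (a + b) * (\<bar>f t\<bar> powr p / a powr p) +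
      b / (a + b) * (\<bar>g t\<bar> powr p / b powr p))" for a b t
  have C_int: "integrable M (C a b)" for a b
    unfolding C_def using f g by (intro integrable_mult_right Bochner_Integration.integrable_add integrable_divide)
  have le: "\<bar>f t + g t\<bar> powr p \<le> C a b t" if ab: "a > 0" "b > 0" for a b t
  proof -
    let ?s = "a / (a + b)" and ?r = "b / (a + b)"
    have eq: "?s * (\<bar>f t\<bar> / a) + ?r * (\<bar>g t\<bar> / b) = (\<bar>f t\<bar> + \<bar>g t\<bar>) / (a + b)"
    proof -
      have "?s * (\<bar>f t\<bar> / a) = \<bar>f t\<bar> / (a + b)" "?r * (\<bar>g t\<bar> / b) = \<bar>g t\<bar> / (a + b)"
        using ab by simp_all
      then show ?thesis by (simp add: add_divide_distrib)
    qed
    have "((\<bar>f t\<bar> + \<bar>g t\<bar>) / (a + b)) powr p \<le> ?s * (\<bar>f t\<bar> / a) powr p + ?r * (\<bar>g t\<bar> / b) powr p"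
      unfolding eq[symmetric]
      by (rule powr_convex_nonneg) (use p ab in \<open>auto simp: add_divide_distrib[symmetric]\<close>)
    then have "(a + b) powr p * ((\<bar>f t\<bar> + \<bar>g t\<bar>) / (a + b)) powr p \<le> C a b t"
      unfolding C_def using ab by (intro mult_left_mono) (auto simp: powr_divide)
    moreover have "(a + b) powr p * ((\<bar>f t\<bar> + \<bar>g t\<bar>) / (a + b)) powr p = (\<bar>f t\<bar> + \<bar>g t\<bar>) powr p"
      using ab by (simp add: powr_divide)
    moreover have "\<bar>f t + g t\<bar> powr p \<le> (\<bar>f t\<bar> + \<bar>g t\<bar>) powr p"
      using p by (intro powr_mono2) auto
    ultimately show ?thesis by linarith
  qed
  show int: "integrable M (\<lambda>t. \<bar>f t + g t\<bar> powr p)"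
    by (rule Bochner_Integration.integrable_bound[OF C_int[of 1 1]])
       (use meas le[of 1 1] in \<open>auto intro: order_trans[OF _ abs_ge_self]\<close>)
  have ub: "(\<integral>t. \<bar>f t + g t\<bar> powr p \<partial>M) powr (1 / p) \<le> a + b" if a: "a > A" and b: "b > B" for a b
  proof -
    have pos: "a > 0" "b > 0" using a b A(1) B(1) by auto
    have "(\<integral>t. \<bar>f t + g t\<bar> powr p \<partial>M) \<le> (\<integral>t. C a b t \<partial>M)"
      by (rule integral_mono[OF int C_int]) (rule le[OF pos])
    also have "\<dots> = (a + b) powr p * (a / (a + b) * (A powr p / a powr p) +
        b / (a + b) * (B powr p / b powr p))"
      unfolding C_def using f g by (simp add: A(2) B(2))
    also have "\<dots> \<le> (a + b) powr p * (a / (a + b) * 1 + b / (a + b) * 1)"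
      using pos a b A(1) B(1) p
      by (intro mult_left_mono add_mono) (auto intro!: powr_mono2 simp: divide_le_eq_1)
    also have "\<dots> = (a + b) powr p"
      using pos by (simp add: add_divide_distrib[symmetric])
    finally have "(\<integral>t. \<bar>f t + g t\<bar> powr p \<partial>M) powr (1 / p) \<le> ((a + b) powr p) powr (1 / p)"
      using p by (intro powr_mono2) auto
    then show ?thesis using pos p by (simp add: powr_powr)
  qed
  have "(\<integral>t. \<bar>f t + g t\<bar> powr p \<partial>M) powr (1 / p) \<le> A + B + e" if "e > 0" for e
    using ub[of "A + e / 2" "B + e / 2"] that by simp
  then have "(\<integral>t. \<bar>f t + g t\<bar> powr p \<partial>M) powr (1 / p) \<le> A + B"
    by (rule field_le_epsilon)
  then show "(\<integral>t. \<bar>f t + g t\<bar> powr p \<partial>M) powr (1 / p) \<le>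
         (\<integral>t. \<bar>f t\<bar> powr p \<partial>M) powr (1 / p) + (\<integral>t. \<bar>g t\<bar> powr p \<partial>M) powr (1 / p)"
    by (simp add: A_def B_def)
qed

lemma Lp_norm_nonneg: "0 \<le> Lp_norm p x"
  by transfer simp

lemma Lp_norm_uminus: "Lp_norm p (- x) = Lp_norm p x"
  by transfer simp

lemma Lp_uminus: "x \<in> Lp p \<Longrightarrow> - x \<in> Lp p"
  unfolding Lp_def mem_Collect_eq by transfer simp

lemma Lp_add_and_norm_triangle:
  assumes "1 \<le> p" "x \<in> Lp p" "y \<in> Lp p"
  shows "x + y \<in> Lp p \<and> Lp_norm p (x + y) \<le> Lp_norm p x + Lp_norm p y"
  using assms unfolding Lp_def mem_Collect_eq
  by transfer (use Minkowski_powr in blast)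

lemma Lp_norm_eq_0_iff:
  assumes "1 \<le> p" "x \<in> Lp p"
  shows "Lp_norm p x = 0 \<longleftrightarrow> x = 0"
  using assms unfolding Lp_def mem_Collect_eq
  by transfer (auto simp: integral_nonneg_eq_0_iff_AE)

lemma Metric_space_Lp:
  assumes p: "1 \<le> p"
  shows "Metric_space (Lp p) (Lp_dist p)"
proof
  have diff: "x - y \<in> Lp p" if "x \<in> Lp p" "y \<in> Lp p" for x y
    using Lp_add_and_norm_triangle[OF p that(1) Lp_uminus[OF that(2)]] by simp
  show "0 \<le> Lp_dist p x y" for x y by (simp add: Lp_dist_def Lp_norm_nonneg)
  show "Lp_dist p x y = Lp_dist p y x" for x y
    using Lp_norm_uminus[of p "x - y"] by (simp add: Lp_dist_def)
  show "Lp_dist p x y = 0 \<longleftrightarrow> x = y" if "x \<in> Lp p" "y \<in> Lp p" for x y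
    using Lp_norm_eq_0_iff[OF p diff[OF that]] by (simp add: Lp_dist_def)
  show "Lp_dist p x z \<le> Lp_dist p x y + Lp_dist p y z"
    if "x \<in> Lp p" "y \<in> Lp p" "z \<in> Lp p" for x y z
    using Lp_add_and_norm_triangle[OF p diff[OF that(1,2)] diff[OF that(2,3)]]
    by (simp add: Lp_dist_def)
qed

lemma bounded_metric_space_Lp_sphere:
  assumes p: "1 \<le> p"
  shows "Metric_space (Lp_sphere p) (Lp_dist p)"
    and "Metric_space.mbounded (Lp_sphere p) (Lp_dist p) (Lp_sphere p)"
proof -
  interpret Lp: Metric_space "Lp p" "Lp_dist p" by (rule Metric_space_Lp[OF p])
  show M: "Metric_space (Lp_sphere p) (Lp_dist p)"
    by (rule Lp.subspace) (auto simp: Lp_sphere_def)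
  have "Lp_dist p x y \<le> 2" if "x \<in> Lp_sphere p" "y \<in> Lp_sphere p" for x y
    using Lp_add_and_norm_triangle[OF p, of x "- y"] Lp_uminus[of y p] that
    by (simp add: Lp_dist_def Lp_sphere_def Lp_norm_uminus)
  then show "Metric_space.mbounded (Lp_sphere p) (Lp_dist p) (Lp_sphere p)"
    unfolding Metric_space.mbounded_alt[OF M] by blast
qed

end

theory Submission
  imports Defs "HOL-Real_Asymp.Real_Asymp"
begin

text \<open>If the Gromov compactification were a factor of \<open>\<nu>\<^sub>p\<close>, the distance to the constant function \<open>1\<close>
  would extend from the sphere to a weakly continuous function \<open>f\<close> on the ball. Two kinds of points
  of the sphere accumulate weakly at \<open>0\<close>: the normalized indicators of short intervals, whose
  distances to \<open>1\<close> tend to \<open>2 powr (1 / p)\<close>, and functions with values in \<open>{1, -1}\<close> and mean \<open>0\<close>, whose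
  distance to \<open>1\<close> is \<open>2 powr (1 - 1 / p)\<close>. Hence \<open>f 0\<close> would have both values, so \<open>p = 2\<close>.
  No description of the dual space is needed: testing a functional \<open>\<phi>\<close> of norm \<open>C\<close> on a sum of signed
  indicators of \<open>N\<close> equal intervals \<open>I\<^sub>j\<close> gives \<open>(\<Sum>j<N. \<bar>\<phi> (1\<^sub>I\<^sub>j)\<bar>) \<le> C\<close>, which makes finitely many
  functionals small on one of the normalized indicators and, by balancing signs, on one of the
  sign functions.

  The closure of the maps \<open>d x\<close> in the product of lines is an equivariant compactification for any
  isometric action on a bounded metric space, and the distance functions extend to it; hence
  \<open>\<nu>\<^sub>p\<close> is not the maximal one.\<close>

section \<open>Compactifications to which the distance functions extend\<close>

lemma gromov_compactification_extends_dist: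
  assumes "gromov_compactification M d K \<gamma>" and z: "z \<in> M"
  obtains f where "continuous_map K euclideanreal f" "\<And>x. x \<in> M \<Longrightarrow> f (\<gamma> x) = d x z"
proof -
  interpret Metric_space M d
    using assms(1) unfolding gromov_compactification_def by blast
  have "(\<lambda>x\<in>M. d x z) \<in> gromov_algebra M d"
    unfolding gromov_algebra_def using z by (intro hull_inc) blast
  then obtain f where "continuous_map K euclideanreal f" "(\<lambda>x\<in>M. d x z) = restrict (f \<circ> \<gamma>) M"
    using assms(1) unfolding gromov_compactification_def corresponds_to_algebra_def by auto
  then show thesis
    using that by (metis comp_apply restrict_apply')
qed

text \<open>Pointwise limits of the functions \<open>\<gamma> x\<close> are still 1-Lipschitz. This
  equicontinuity makes the action on the closure jointly continuous, although a neighbourhood in the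
  product topology controls only finitely many coordinates.\<close>

lemma ex_equivariant_compactification_extends_dist:
  fixes M :: "'a set"
  assumes met: "Metric_space M d" and bdd: "Metric_space.mbounded M d M"
    and GX: "G_space G \<tau> (Metric_space.mtopology M d) act"
    and iso: "\<And>g x y. g \<in> carrier G \<Longrightarrow> x \<in> M \<Longrightarrow> y \<in> M \<Longrightarrow> d (act g x) (act g y) = d x y"
  obtains K :: "('a \<Rightarrow> real) topology" and actK \<gamma>
  where "equivariant_compactification G \<tau> (Metric_space.mtopology M d) act K actK \<gamma>"
    and "\<And>z. z \<in> M \<Longrightarrow> continuous_map K euclideanreal (\<lambda>k. k z)"
    and "\<And>x z. x \<in> M \<Longrightarrow> z \<in> M \<Longrightarrow> \<gamma> x z = d x z"
proof -
  interpret Metric_space M d by (fact met)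
  have tg: "topological_group G \<tau>"
    and act_cont: "continuous_map (prod_topology \<tau> mtopology) mtopology (\<lambda>(g, x). act g x)"
    and act_one: "\<And>x. x \<in> M \<Longrightarrow> act \<one>\<^bsub>G\<^esub> x = x"
    and act_mult: "\<And>g h x. g \<in> carrier G \<Longrightarrow> h \<in> carrier G \<Longrightarrow> x \<in> M \<Longrightarrow>
        act (g \<otimes>\<^bsub>G\<^esub> h) x = act g (act h x)"
    using GX unfolding G_space_def by auto
  interpret G: group G using tg by (simp add: topological_group_def)
  have top: "topspace \<tau> = carrier G" using tg by (simp add: topological_group_def)
  have act_in: "act g x \<in> M" if "g \<in> carrier G" "x \<in> M" for g x
    using continuous_map_image_subset_topspace[OF act_cont] top that by fastforce
  have act_inv: "act g (act (inv\<^bsub>G\<^esub> g) x) = x" if "g \<in> carrier G" "x \<in> M" for g x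
    using act_mult[of g "inv\<^bsub>G\<^esub> g" x] act_one that by simp
  obtain B where B: "\<And>x y. x \<in> M \<Longrightarrow> y \<in> M \<Longrightarrow> d x y \<le> B"
    using bdd unfolding mbounded_alt by blast
  define \<gamma> where "\<gamma> x = (\<lambda>z. if z \<in> M then d x z else 0)" for x
  define T where "T = closure (\<gamma> ` M)"
  define K where "K = top_of_set T"
  \<comment> \<open>Forced by equivariance: d(g x, z) = d(x, g^-1 z) for an isometric
    action.\<close>
  define aK where "aK g k = (\<lambda>z. if z \<in> M then k (act (inv\<^bsub>G\<^esub> g) z) else 0)" for g and k :: "'a \<Rightarrow> real"
  \<comment> \<open>Collects the closed conditions that pass from \<open>\<gamma> x\<close> to the
    closure. Vanishing off \<open>M\<close> makes the unit act as the identity; the last condition,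
    used for both orders of \<open>z\<close> and \<open>w\<close>, is the Lipschitz bound.\<close>
  define Q where "Q = {k :: 'a \<Rightarrow> real. (\<forall>z. z \<notin> M \<longrightarrow> k z = 0) \<and>
     (\<forall>z\<in>M. 0 \<le> k z \<and> k z \<le> B) \<and> (\<forall>z\<in>M. \<forall>w\<in>M. k z - k w \<le> d z w)}"
  have "Q = (\<Inter>z\<in>- M. {k. k z = 0}) \<inter> (\<Inter>z\<in>M. {k. 0 \<le> k z} \<inter> {k. k z \<le> B}) \<inter>
      (\<Inter>z\<in>M. \<Inter>w\<in>M. {k. k z - k w \<le> d z w})"
    unfolding Q_def by auto
  also have "closed \<dots>"
    by (intro closed_Int closed_INT ballI closed_Collect_le closed_Collect_eq continuous_on_diff
          continuous_on_const continuous_on_product_coordinates)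
  finally have clQ: "closed Q" .
  have "d x z - d x w \<le> d z w" if "x \<in> M" "z \<in> M" "w \<in> M" for x z w
    using triangle[of x w z] that by (simp add: commute)
  then have "\<gamma> x \<in> Q" if "x \<in> M" for x
    unfolding Q_def \<gamma>_def using B that by simp
  then have TQ: "T \<subseteq> Q"
    unfolding T_def by (intro closure_minimal clQ) blast
  define C where "C = (\<Pi>\<^sub>E z\<in>UNIV. if z \<in> M then {0..B} else {0::real})"
  have "compactin (product_topology (\<lambda>_. euclideanreal) UNIV) C"
    unfolding C_def by (subst compactin_PiE) auto
  then have "compact C" by (simp add: euclidean_product_topology)
  moreover have "T \<subseteq> C"
    by (rule order_trans[OF TQ]) (auto simp: C_def Q_def PiE_iff)
  ultimately have cT: "compact T"
    using compact_Int_closed[of C T] by (simp add: T_def Int_absorb1)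
  have \<gamma>_in: "\<gamma> x \<in> T" if "x \<in> M" for x
    unfolding T_def by (rule subsetD[OF closure_subset]) (rule imageI[OF that])
  have \<gamma>_cont: "continuous_map mtopology K \<gamma>"
    unfolding K_def continuous_map_in_subtopology euclidean_product_topology[symmetric]
      continuous_map_componentwise_UNIV
  proof (intro conjI allI)
    show "continuous_map mtopology euclideanreal (\<lambda>x. \<gamma> x z)" for z
      using continuous_map_mdist[of mtopology "metric (M, d)" "\<lambda>x. x" "\<lambda>_. z"]
      by (cases "z \<in> M") (simp_all add: \<gamma>_def)
  qed (use \<gamma>_in in auto)
  have K_coord: "continuous_map K euclideanreal (\<lambda>k. k z)" for z
    unfolding K_def by (auto intro: continuous_on_subset[OF continuous_on_product_coordinates])
  have topK: "topspace K = T" by (simp add: K_def)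
  have haus: "Hausdorff_space K"
    unfolding K_def euclidean_product_topology[symmetric]
    by (simp add: Hausdorff_space_subtopology Hausdorff_space_product_topology)
  have cpt: "compact_space K" unfolding K_def using cT by (simp add: compact_space_subtopology)
  have comp: "compactification mtopology K \<gamma>"
    unfolding compactification_def
  proof (intro conjI \<gamma>_cont haus cpt)
    have "\<gamma> ` M \<subseteq> T" using \<gamma>_in by blast
    then show "K closure_of \<gamma> ` topspace mtopology = topspace K"
      unfolding K_def by (simp add: closure_of_subtopology Int_absorb1 T_def)
  qed
  have equi: "\<gamma> (act g x) = aK g (\<gamma> x)" if "g \<in> carrier G" "x \<in> M" for g x
  proof
    fix z show "\<gamma> (act g x) z = aK g (\<gamma> x) z"
      using iso[of g x "act (inv\<^bsub>G\<^esub> g) z"] that act_inv act_in by (auto simp: \<gamma>_def aK_def)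
  qed
  \<comment> \<open>\<open>aK g\<close> is continuous on the whole function space and maps the image
    of \<open>\<gamma>\<close> into itself by \<open>equi\<close>, hence preserves its
    closure.\<close>
  have aK_in: "aK g k \<in> T" if "g \<in> carrier G" "k \<in> T" for g k
  proof -
    have "continuous_on UNIV (aK g)"
      unfolding aK_def
    proof (rule continuous_on_coordinatewise_then_product)
      show "continuous_on UNIV (\<lambda>k::'a \<Rightarrow> real. if i \<in> M then k (act (inv\<^bsub>G\<^esub> g) i) else 0)" for i
        by (cases "i \<in> M") (simp_all add: continuous_on_product_coordinates)
    qed
    then have "aK g ` T \<subseteq> closure (aK g ` \<gamma> ` M)"
      unfolding T_def by (intro image_closure_subset[OF _ closed_closure closure_subset])
         (auto intro: continuous_on_subset)
    also have "\<dots> \<subseteq> T"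
      unfolding T_def using equi act_in that(1) by (intro closure_mono) force
    finally show ?thesis using that by blast
  qed
  have aK_cont: "continuous_map (prod_topology \<tau> K) euclideanreal (\<lambda>(g, k). aK g k z)" for z
  proof (cases "z \<in> M")
    case False
    then show ?thesis by (simp add: aK_def case_prod_unfold)
  next
    case z: True
    show ?thesis
      unfolding mtopology_is_euclidean[symmetric] Met_TC.continuous_map_to_metric
    proof (intro ballI allI impI, clarify)
      fix g0 k0 and e :: real
      assume gk: "(g0, k0) \<in> topspace (prod_topology \<tau> K)" and e: "0 < e"
      then have g0: "g0 \<in> carrier G" and k0: "k0 \<in> T" using top topK by auto
      \<comment> \<open>With v = g^-1 z, the quantity to bound is |k v - k0 w| \<le> |k v - k w| +
        |k w - k0 w|. The Lipschitz bound reduces the first term to d(v, w) = d(z, g w), which is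
        small for g near g0 because g0 w = z; the second is small for k near k0 in the single
        coordinate w.\<close>
      define w where "w = act (inv\<^bsub>G\<^esub> g0) z"
      have w: "w \<in> M" "act g0 w = z" unfolding w_def using act_in act_inv g0 z by auto
      have "continuous_map \<tau> mtopology (\<lambda>g. act g w)"
        using continuous_map_compose[OF _ act_cont, of \<tau> "\<lambda>g. (g, w)"] w(1)
        by (simp add: o_def continuous_map_pairwise)
      then obtain U where U: "openin \<tau> U" "g0 \<in> U" "\<And>g. g \<in> U \<Longrightarrow> d z (act g w) < e / 2"
        unfolding continuous_map_to_metric using g0 top e w 
        by (metis half_gt_zero in_mball)
      obtain V where V: "openin K V" "k0 \<in> V" "\<And>k. k \<in> V \<Longrightarrow> \<bar>k w - k0 w\<bar> < e / 2"
        using K_coord[of w] k0 topK e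
        unfolding mtopology_is_euclidean[symmetric] Met_TC.continuous_map_to_metric
        by (metis Met_TC.in_mball dist_commute dist_real_def half_gt_zero)
      show "\<exists>W. openin (prod_topology \<tau> K) W \<and> (g0, k0) \<in> W \<and>
          (\<forall>y\<in>W. (case y of (g, k) \<Rightarrow> aK g k z) \<in> Met_TC.mball (aK g0 k0 z) e)"
      proof (intro exI[of _ "U \<times> V"] conjI ballI)
        show "openin (prod_topology \<tau> K) (U \<times> V)"
          using U(1) V(1) by (simp add: openin_prod_Times_iff)
        show "(g0, k0) \<in> U \<times> V" using U V by simp
        fix y assume "y \<in> U \<times> V"
        then obtain g k where y: "y = (g, k)" "g \<in> U" "k \<in> V" by blast
        have g: "g \<in> carrier G" and k: "k \<in> T"
          using y U(1) V(1) top topK openin_subset by blast+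
        define v where "v = act (inv\<^bsub>G\<^esub> g) z"
        have v: "v \<in> M" "act g v = z" unfolding v_def using act_in act_inv g z by auto
        have "d v w = d z (act g w)" using iso[OF g v(1) w(1)] v(2) by simp
        then have "d v w < e / 2" using U(3)[OF y(2)] by simp
        moreover have "\<bar>k v - k w\<bar> \<le> d v w"
          using k TQ v(1) w(1) commute[of v w] unfolding Q_def by (fastforce simp: abs_le_iff)
        ultimately have "\<bar>k v - k0 w\<bar> < e"
          using V(3)[OF y(3)] by linarith
        then show "(case y of (g, k) \<Rightarrow> aK g k z) \<in> Met_TC.mball (aK g0 k0 z) e"
          using z y by (simp add: aK_def v_def w_def dist_real_def abs_minus_commute)
      qed
    qed
  qed
  have "G_space G \<tau> K aK"
    unfolding G_space_def
  proof (intro conjI ballI tg)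
    show "tychonoff_space K"
      unfolding tychonoff_space_def using haus cpt
      by (simp add: compact_Hausdorff_or_regular_imp_normal_space
          normal_imp_completely_regular_space Hausdorff_imp_t1_space)
    show "continuous_map (prod_topology \<tau> K) K (\<lambda>(g, k). aK g k)"
      (is "continuous_map ?X K ?f")
    proof -
      have "continuous_map ?X euclidean ?f"
        unfolding euclidean_product_topology[symmetric] continuous_map_componentwise_UNIV
        using aK_cont by (simp add: case_prod_unfold)
      moreover have "?f ` topspace ?X \<subseteq> T" using aK_in top topK by auto
      ultimately have "continuous_map ?X (top_of_set T) ?f"
        unfolding continuous_map_in_subtopology by (auto simp: image_subset_iff)
      then show ?thesis by (simp only: K_def)
    qed
    fix k assume "k \<in> topspace K"
    then have k: "k \<in> T" "k \<in> Q" using topK TQ by auto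
    show "aK \<one>\<^bsub>G\<^esub> k = k"
      using k(2) act_one by (auto simp: aK_def Q_def)
    fix g h assume "g \<in> carrier G" "h \<in> carrier G"
    then show "aK (g \<otimes>\<^bsub>G\<^esub> h) k = aK g (aK h k)"
      using act_in act_mult by (auto simp: aK_def G.inv_mult_group)
  qed
  then have "equivariant_compactification G \<tau> mtopology act K aK \<gamma>"
    unfolding equivariant_compactification_def using GX comp equi by simp
  then show thesis
    using that K_coord by (simp add: \<gamma>_def)
qed

section \<open>Step functions on equal intervals\<close>

lemma borel_measurable_unit_interval_measure:
  "f \<in> borel_measurable borel \<Longrightarrow> f \<in> borel_measurable unit_interval_measure"
  by (intro measurable_restrict_space1 measurable_completion) simp

lemma borel_measurable_step:
  fixes c :: "nat \<Rightarrow> real"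
  shows "(\<lambda>t. c (nat \<lfloor>real N * t\<rfloor>)) \<in> borel_measurable unit_interval_measure"
proof (rule borel_measurable_unit_interval_measure)
  have "(\<lambda>t. nat \<lfloor>real N * t\<rfloor>) \<in> borel \<rightarrow>\<^sub>M count_space UNIV" by measurable
  then show "(\<lambda>t. c (nat \<lfloor>real N * t\<rfloor>)) \<in> borel_measurable borel"
    by (rule measurable_compose) simp
qed

text \<open>On \<open>[j/N, (j+1)/N)\<close> the value is \<open>c j\<close>; the value \<open>c N\<close> is taken only at \<open>t = 1\<close>.\<close>

lift_definition Lp_step :: "nat \<Rightarrow> (nat \<Rightarrow> real) \<Rightarrow> L0" is "\<lambda>N c t. c (nat \<lfloor>real N * t\<rfloor>)"
  subgoal for N c
    by (rule conjI[OF borel_measurable_step[of c N] conjI[OF borel_measurable_step[of c N]]], rule AE_I2, rule refl)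
  done

lemma Lp_step_add: "Lp_step N (\<lambda>j. c j + c' j) = Lp_step N c + Lp_step N c'"
  by transfer (intro conjI AE_I2 refl borel_measurable_add borel_measurable_diff
      borel_measurable_times borel_measurable_const borel_measurable_step)

lemma Lp_step_diff: "Lp_step N (\<lambda>j. c j - c' j) = Lp_step N c - Lp_step N c'"
  by transfer (intro conjI AE_I2 refl borel_measurable_add borel_measurable_diff
      borel_measurable_times borel_measurable_const borel_measurable_step)

lemma Lp_step_scaleR: "Lp_step N (\<lambda>j. r * c j) = r *\<^sub>R Lp_step N c"
  by transfer (intro conjI AE_I2 refl borel_measurable_add borel_measurable_diff
      borel_measurable_times borel_measurable_const borel_measurable_step)

lemma Lp_step_const: "Lp_step N (\<lambda>_. r) = Lp_step N' (\<lambda>_. r)"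
  by transfer (intro conjI AE_I2 refl borel_measurable_add borel_measurable_diff
      borel_measurable_times borel_measurable_const borel_measurable_step)

lemma has_bochner_integral_step:
  fixes c :: "nat \<Rightarrow> real"
  assumes N: "0 < N"
  shows "has_bochner_integral unit_interval_measure (\<lambda>t. c (nat \<lfloor>real N * t\<rfloor>)) ((\<Sum>j<N. c j) / N)"
proof -
  let ?I = "\<lambda>j. {real j / N..<real (Suc j) / N}"
  have I: "?I j \<subseteq> {0..1}" if "j < N" for j
  proof -
    have "real (Suc j) / N \<le> 1" using that N by (simp add: divide_le_eq_1)
    moreover have "0 \<le> real j / N" by simp
    ultimately show ?thesis
      by (intro subsetI) (simp only: atLeastLessThan_iff atLeastAtMost_iff, linarith)
  qed
  have c_I: "has_bochner_integral unit_interval_measure (\<lambda>t. c j * indicator (?I j) t) (c j * (1 / N))"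
    if j: "j < N" for j
  proof (rule has_bochner_integral_mult_right)
    have e: "emeasure unit_interval_measure (?I j) = ennreal (1 / N)"
      using I[OF j] N by (simp add: emeasure_restrict_space diff_divide_distrib[symmetric] divide_right_mono)
    have "?I j \<in> sets unit_interval_measure" using I[OF j] by (auto simp: sets_restrict_space_iff)
    then show "has_bochner_integral unit_interval_measure (indicator (?I j)) (1 / real N)"
      using has_bochner_integral_real_indicator[of "?I j" unit_interval_measure] e
      by (simp add: measure_def)
  qed
  have eq: "(\<Sum>j<N. c j) / N = (\<Sum>j<N. c j * (1 / N))" by (simp add: sum_divide_distrib)
  have "has_bochner_integral unit_interval_measure (\<lambda>t. \<Sum>j<N. c j * indicator (?I j) t)
      ((\<Sum>j<N. c j) / N)"
    unfolding eq by (rule has_bochner_integral_sum) (rule c_I, simp only: lessThan_iff)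
  also have "?this \<longleftrightarrow> ?thesis"
  proof (rule has_bochner_integral_cong_AE)
    show "(\<lambda>t. \<Sum>j<N. c j * indicator (?I j) t) \<in> borel_measurable unit_interval_measure"
      by (rule borel_measurable_unit_interval_measure) measurable
    show "(\<lambda>t. c (nat \<lfloor>real N * t\<rfloor>)) \<in> borel_measurable unit_interval_measure"
      by (rule borel_measurable_step)
    \<comment> \<open>At t = 1 no interval \<open>?I j\<close> is hit, while the step function takes
      the value \<open>c N\<close>; elsewhere on the unit interval both functions agree.\<close>
    have "AE t in lebesgue. t \<noteq> (1::real)"
      by (rule AE_completion) (rule AE_lborel_singleton)
    then have "AE t in unit_interval_measure. t \<noteq> (1::real)"
      by (subst AE_restrict_space_iff) auto
    then show "AE t in unit_interval_measure. (\<Sum>j<N. c j * indicator (?I j) t) = c (nat \<lfloor>real N * t\<rfloor>)"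
    proof (rule AE_mp, intro AE_I2 impI)
      fix t assume "t \<in> space unit_interval_measure" "t \<noteq> 1"
      then have t: "0 \<le> t" "t < 1" by auto
      define m where "m = nat \<lfloor>real N * t\<rfloor>"
      have m: "m < N" using t N unfolding m_def by (simp add: nat_less_iff floor_less_iff)
      have "t \<in> ?I j \<longleftrightarrow> j = m" for j
      proof -
        have "t \<in> ?I j \<longleftrightarrow> real j \<le> real N * t \<and> real N * t < real j + 1"
          using N by (auto simp: field_simps)
        also have "\<dots> \<longleftrightarrow> \<lfloor>real N * t\<rfloor> = int j"
          by (auto simp: floor_eq_iff)
        also have "\<dots> \<longleftrightarrow> j = m"
          using t unfolding m_def by auto
        finally show ?thesis .
      qed
      then have "(\<Sum>j<N. c j * indicator (?I j) t) = (\<Sum>j<N. if j = m then c j else 0)"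
        by (intro sum.cong) auto
      then show "(\<Sum>j<N. c j * indicator (?I j) t) = c (nat \<lfloor>real N * t\<rfloor>)"
        using m by (simp add: m_def[symmetric])
    qed
  qed
  finally show ?thesis .
qed

lemma step_powr:
  fixes c :: "nat \<Rightarrow> real"
  assumes "0 < N"
  shows "integrable unit_interval_measure (\<lambda>t. \<bar>c (nat \<lfloor>real N * t\<rfloor>)\<bar> powr p)"
    and "(\<integral>t. \<bar>c (nat \<lfloor>real N * t\<rfloor>)\<bar> powr p \<partial>unit_interval_measure) = (\<Sum>j<N. \<bar>c j\<bar> powr p) / N"
  using has_bochner_integral_step[OF assms, of "\<lambda>j. \<bar>c j\<bar> powr p"]
  by (simp_all add: has_bochner_integral_iff)

lemma Lp_step_in_Lp: "0 < N \<Longrightarrow> Lp_step N c \<in> Lp p"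
  unfolding Lp_def mem_Collect_eq by transfer (rule step_powr)

lemma Lp_norm_step: "0 < N \<Longrightarrow> Lp_norm p (Lp_step N c) = ((\<Sum>j<N. \<bar>c j\<bar> powr p) / N) powr (1 / p)"
  by transfer (simp add: step_powr)

section \<open>Bounded functionals on indicators of equal intervals\<close>

definition Lp_bump :: "nat \<Rightarrow> nat \<Rightarrow> L0" where
  "Lp_bump N j = Lp_step N (\<lambda>i. if i = j then 1 else 0)"

lemma Lp_dual_bound:
  assumes "finite F" "F \<subseteq> Lp_dual p"
  obtains C where "0 \<le> C" "\<And>\<phi> x. \<phi> \<in> F \<Longrightarrow> x \<in> Lp p \<Longrightarrow> \<bar>\<phi> x\<bar> \<le> C * Lp_norm p x"
proof -
  have "\<exists>C\<ge>0. \<forall>\<phi>\<in>F. \<forall>x\<in>Lp p. \<bar>\<phi> x\<bar> \<le> C * Lp_norm p x"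
    using assms
  proof (induction F)
    case empty
    show ?case by (intro exI[of _ 0]) simp
  next
    case (insert \<phi> F)
    then obtain C where C: "0 \<le> C" "\<forall>\<phi>\<in>F. \<forall>x\<in>Lp p. \<bar>\<phi> x\<bar> \<le> C * Lp_norm p x" by blast
    obtain D where D: "\<forall>x\<in>Lp p. \<bar>\<phi> x\<bar> \<le> D * Lp_norm p x"
      using insert.prems unfolding Lp_dual_def by blast
    have *: "E * Lp_norm p x \<le> max C D * Lp_norm p x" if "E = C \<or> E = D" for E x
      using that by (intro mult_right_mono Lp_norm_nonneg) auto
    have "\<forall>\<psi>\<in>insert \<phi> F. \<forall>x\<in>Lp p. \<bar>\<psi> x\<bar> \<le> max C D * Lp_norm p x"
      using C(2) D order_trans[OF _ *] by blast
    then show ?case using C(1) by (intro exI[of _ "max C D"]) simp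
  qed
  then show thesis using that by blast
qed

lemma Lp_dual_step:
  assumes \<phi>: "\<phi> \<in> Lp_dual p" and p: "p > 0" and N: "0 < N"
  shows "\<phi> (Lp_step N c) = (\<Sum>j<N. c j * \<phi> (Lp_bump N j))"
proof -
  have add: "\<phi> (Lp_step N (\<lambda>i. a i + b i)) = \<phi> (Lp_step N a) + \<phi> (Lp_step N b)"
    and scale: "\<phi> (Lp_step N (\<lambda>i. r * a i)) = r * \<phi> (Lp_step N a)" for a b r
    using \<phi> N by (auto simp: Lp_dual_def Lp_step_add Lp_step_scaleR Lp_step_in_Lp)
  obtain C where C: "\<And>x. x \<in> Lp p \<Longrightarrow> \<bar>\<phi> x\<bar> \<le> C * Lp_norm p x"
    using \<phi> unfolding Lp_dual_def by blast
  have trunc: "\<phi> (Lp_step N (\<lambda>i. if i < n then c i else 0)) = (\<Sum>j<n. c j * \<phi> (Lp_bump N j))" for n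
  proof (induction n)
    case 0
    show ?case using scale[of 0] by simp
  next
    case (Suc n)
    have "(\<lambda>i. if i < Suc n then c i else 0) =
        (\<lambda>i. (if i < n then c i else 0) + c n * (if i = n then 1 else 0))"
      by (auto simp: less_Suc_eq)
    then show ?case by (simp only: add scale Suc) (simp add: Lp_bump_def)
  qed
  \<comment> \<open>The sum omits the coefficients from index N on. They live on the null set t = 1,
    so this remainder has norm 0 and the bound on \<open>\<phi>\<close> kills it.\<close>
  define r where "r = (\<lambda>i. if i < N then 0 else c i)"
  have "Lp_norm p (Lp_step N r) = 0"
    using p N by (simp add: Lp_norm_step r_def)
  then have "\<phi> (Lp_step N r) = 0"
    using C[of "Lp_step N r"] N by (simp add: Lp_step_in_Lp)
  moreover have "c = (\<lambda>i. (if i < N then c i else 0) + r i)"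
    by (auto simp: r_def)
  ultimately show ?thesis
    using add[of "\<lambda>i. if i < N then c i else 0" r] trunc[of N] by simp
qed

lemma sum_abs_Lp_dual_bump_le:
  assumes \<phi>: "\<phi> \<in> Lp_dual p" and p: "p > 0" and N: "0 < N"
    and C: "\<And>x. x \<in> Lp p \<Longrightarrow> \<bar>\<phi> x\<bar> \<le> C * Lp_norm p x"
  shows "(\<Sum>j<N. \<bar>\<phi> (Lp_bump N j)\<bar>) \<le> C"
proof -
  \<comment> \<open>Each term of the expansion becomes an absolute value. The sign is never 0, so
    the test function has norm exactly 1.\<close>
  define s where "s j = (if \<phi> (Lp_bump N j) < 0 then - 1 else 1 :: real)" for j
  have "(\<Sum>j<N. \<bar>\<phi> (Lp_bump N j)\<bar>) = \<phi> (Lp_step N s)"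
    unfolding Lp_dual_step[OF \<phi> p N] by (intro sum.cong) (auto simp: s_def)
  also have "\<dots> \<le> C * Lp_norm p (Lp_step N s)"
    using C[OF Lp_step_in_Lp[OF N], of s] by simp
  also have "\<bar>s j\<bar> = 1" for j by (simp add: s_def)
  then have "Lp_norm p (Lp_step N s) = 1"
    using N by (simp add: Lp_norm_step)
  finally show ?thesis by simp
qed

lemma Lp_norm_bump:
  assumes "p > 0" "j < N"
  shows "Lp_norm p (Lp_bump N j) = real N powr (- 1 / p)"
proof -
  have "(\<Sum>i<N. \<bar>if i = j then 1 else 0 :: real\<bar> powr p) = (\<Sum>i<N. if i = j then 1 else 0)"
    by (intro sum.cong) auto
  with assms show ?thesis
    unfolding Lp_bump_def by (simp add: Lp_norm_step powr_divide powr_minus_divide)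
qed

section \<open>Unit vectors on which finitely many functionals are small\<close>

text \<open>Greedy choice of signs: adding the n-th column changes the sum of squares by the squares
  of that column plus a cross term whose sign can be chosen. Only the cross term summed over
  \<open>F\<close> matters, so one sequence of signs serves all rows at once.\<close>

lemma ex_signs_sum_squares_le:
  fixes b :: "'i \<Rightarrow> nat \<Rightarrow> real"
  shows "\<exists>s. (\<forall>j. s j \<in> {1, - 1}) \<and>
    (\<Sum>i\<in>F. (\<Sum>j<n. s j * b i j)\<^sup>2) \<le> (\<Sum>i\<in>F. \<Sum>j<n. (b i j)\<^sup>2)"
proof (induction n)
  case 0
  show ?case by (intro exI[of _ "\<lambda>_. 1"]) simp
next
  case (Suc n)
  then obtain s where s: "\<And>j. s j \<in> {1, - 1}"
    "(\<Sum>i\<in>F. (\<Sum>j<n. s j * b i j)\<^sup>2) \<le> (\<Sum>i\<in>F. \<Sum>j<n. (b i j)\<^sup>2)" by blast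
  define v where "v i = (\<Sum>j<n. s j * b i j)" for i
  define r :: real where "r = (if (\<Sum>i\<in>F. v i * b i n) \<le> 0 then 1 else - 1)"
  define s' where "s' = s(n := r)"
  have r: "r\<^sup>2 = 1" "r * (\<Sum>i\<in>F. v i * b i n) \<le> 0" by (auto simp: r_def)
  have "(\<Sum>i\<in>F. (\<Sum>j<Suc n. s' j * b i j)\<^sup>2) = (\<Sum>i\<in>F. (v i + r * b i n)\<^sup>2)"
    by (intro sum.cong arg_cong[where f = "\<lambda>x. x\<^sup>2"]) (auto simp: s'_def v_def)
  also have "\<dots> = (\<Sum>i\<in>F. (v i)\<^sup>2 + (b i n)\<^sup>2 + 2 * (r * (v i * b i n)))"
    by (intro sum.cong) (auto simp: power2_sum power_mult_distrib r(1))
  also have "\<dots> = (\<Sum>i\<in>F. (v i)\<^sup>2) + (\<Sum>i\<in>F. (b i n)\<^sup>2) + 2 * (r * (\<Sum>i\<in>F. v i * b i n))"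
    by (simp add: sum.distrib sum_distrib_left)
  also have "\<dots> \<le> (\<Sum>i\<in>F. \<Sum>j<n. (b i j)\<^sup>2) + (\<Sum>i\<in>F. (b i n)\<^sup>2)"
    using r(2) s(2) unfolding v_def by linarith
  also have "\<dots> = (\<Sum>i\<in>F. \<Sum>j<Suc n. (b i j)\<^sup>2)"
    by (simp add: sum.distrib)
  finally show ?case using s(1) by (intro exI[of _ s']) (auto simp: s'_def r_def)
qed

lemma sum_lessThan_double:
  fixes f :: "nat \<Rightarrow> 'a :: comm_monoid_add"
  shows "(\<Sum>j<2 * n. f j) = (\<Sum>j<n. f (2 * j) + f (2 * j + 1))"
  by (induction n) (simp_all add: add.assoc)

text \<open>By averaging, some interval carries at most \<open>B / N\<close> of the functionals'
  total mass on indicators. Normalizing its indicator costs a factor N^(1/p), and N^(1/p - 1) tends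
  to 0 because p > 1. The bound holds for all large N, not just one, because the distances to 1
  reach their limit only as N grows.\<close>

lemma eventually_ex_Lp_bump_near_0:
  assumes p: "1 < p" and F: "finite F" "F \<subseteq> Lp_dual p" and e: "0 < e"
  shows "\<forall>\<^sub>F N in sequentially. \<exists>n<N. \<forall>\<phi>\<in>F.
           \<bar>\<phi> (Lp_step N (\<lambda>i. if i = n then real N powr (1 / p) else 0))\<bar> < e"
proof -
  obtain C where C: "\<And>\<phi> x. \<phi> \<in> F \<Longrightarrow> x \<in> Lp p \<Longrightarrow> \<bar>\<phi> x\<bar> \<le> C * Lp_norm p x"
    using Lp_dual_bound[OF F] by blast
  define B where "B = card F * C"
  have "((\<lambda>N. real N powr (1 / p) * (B / real N)) \<longlongrightarrow> 0) sequentially"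
    using p by real_asymp
  then have "\<forall>\<^sub>F N in sequentially. real N powr (1 / p) * (B / real N) < e"
    using e by (rule order_tendstoD(2))
  then show ?thesis
    using eventually_gt_at_top[of 0]
  proof eventually_elim
    case (elim N)
    have dual: "\<phi> \<in> Lp_dual p" if "\<phi> \<in> F" for \<phi> using F that by blast
    have "(\<Sum>n<N. \<Sum>\<phi>\<in>F. \<bar>\<phi> (Lp_bump N n)\<bar>) = (\<Sum>\<phi>\<in>F. \<Sum>n<N. \<bar>\<phi> (Lp_bump N n)\<bar>)"
      by (rule sum.swap)
    also have "\<dots> \<le> (\<Sum>\<phi>\<in>F. C)"
      using p elim C dual by (intro sum_mono sum_abs_Lp_dual_bump_le[of _ p]) auto
    finally have "(\<Sum>n<N. \<Sum>\<phi>\<in>F. \<bar>\<phi> (Lp_bump N n)\<bar>) \<le> (\<Sum>n<N. B / N)"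
      using elim by (simp add: B_def)
    \<comment> \<open>Were all summands above the average \<open>B / N\<close>, the double sum would
      exceed its bound.\<close>
    then obtain n where n: "n < N" "(\<Sum>\<phi>\<in>F. \<bar>\<phi> (Lp_bump N n)\<bar>) \<le> B / N"
      using sum_strict_mono[of "{..<N}" "\<lambda>_. B / N" "\<lambda>n. \<Sum>\<phi>\<in>F. \<bar>\<phi> (Lp_bump N n)\<bar>"] elim
      by (metis finite_lessThan lessThan_empty_iff lessThan_iff not_gr_zero not_le)
    have "\<bar>\<phi> (Lp_step N (\<lambda>i. if i = n then real N powr (1 / p) else 0))\<bar> < e" if \<phi>: "\<phi> \<in> F" for \<phi>
    proof -
      have "(\<Sum>j<N. (if j = n then real N powr (1 / p) else 0) * \<phi> (Lp_bump N j)) =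
          (\<Sum>j<N. if j = n then real N powr (1 / p) * \<phi> (Lp_bump N j) else 0)"
        by (intro sum.cong) auto
      then have "\<bar>\<phi> (Lp_step N (\<lambda>i. if i = n then real N powr (1 / p) else 0))\<bar> =
          real N powr (1 / p) * \<bar>\<phi> (Lp_bump N n)\<bar>"
        using p elim n(1) by (simp add: Lp_dual_step[OF dual[OF \<phi>]] abs_mult)
      also have "\<bar>\<phi> (Lp_bump N n)\<bar> \<le> B / N"
        using member_le_sum[of \<phi> F "\<lambda>\<phi>. \<bar>\<phi> (Lp_bump N n)\<bar>"] F(1) \<phi> n(2) by simp
      finally show ?thesis using elim(1) by (simp add: mult_left_mono)
    qed
    then show ?case using n(1) by blast
  qed
qed

text \<open>Opposite values on the two halves of each pair of neighbouring intervals: a combination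
  of Haar functions of one level. The mean is 0 for every \<open>s\<close>, so the signs remain free
  for balancing.\<close>

definition haar_signs :: "(nat \<Rightarrow> real) \<Rightarrow> nat \<Rightarrow> real" where
  "haar_signs s i = (if even i then s (i div 2) else - s (i div 2))"

text \<open>Sign balancing bounds the squares of all \<open>\<phi>\<close> values by the sum of the
  squares \<open>(b \<phi> j)\<^sup>2\<close>. For each \<open>\<phi>\<close> that sum is at most
  the largest entry times the l1 sum: the latter is bounded by \<open>C\<close>, the former tends to
  0 with N.\<close>

lemma eventually_ex_Lp_haar_near_0:
  assumes p: "1 < p" and F: "finite F" "F \<subseteq> Lp_dual p" and e: "0 < e"
  shows "\<forall>\<^sub>F N in sequentially. \<exists>s. (\<forall>j. s j \<in> {1, - 1}) \<and>
           (\<forall>\<phi>\<in>F. \<bar>\<phi> (Lp_step (2 * N) (haar_signs s))\<bar> < e)"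
proof -
  obtain C where C: "0 \<le> C" "\<And>\<phi> x. \<phi> \<in> F \<Longrightarrow> x \<in> Lp p \<Longrightarrow> \<bar>\<phi> x\<bar> \<le> C * Lp_norm p x"
    using Lp_dual_bound[OF F] by blast
  \<comment> \<open>Bounds \<open>b \<phi> j\<close>, a difference of two values of
    \<open>\<phi>\<close> on indicators of norm (2N)^(-1/p).\<close>
  define \<delta> where "\<delta> N = 2 * C * (2 * real N) powr (- 1 / p)" for N
  have "((\<lambda>N. real (card F) * (\<delta> N * C)) \<longlongrightarrow> 0) sequentially"
    unfolding \<delta>_def using p by real_asymp
  then have "\<forall>\<^sub>F N in sequentially. real (card F) * (\<delta> N * C) < e\<^sup>2"
    using e by (intro order_tendstoD(2)) auto
  then show ?thesis
    using eventually_gt_at_top[of 0]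
  proof eventually_elim
    case (elim N)
    have dual: "\<phi> \<in> Lp_dual p" if "\<phi> \<in> F" for \<phi> using F that by blast
    define b where "b \<phi> j = \<phi> (Lp_bump (2 * N) (2 * j)) - \<phi> (Lp_bump (2 * N) (2 * j + 1))"
      for \<phi> :: "L0 \<Rightarrow> real" and j
    obtain s where s: "\<And>j. s j \<in> {1, - 1}"
      "(\<Sum>\<phi>\<in>F. (\<Sum>j<N. s j * b \<phi> j)\<^sup>2) \<le> (\<Sum>\<phi>\<in>F. \<Sum>j<N. (b \<phi> j)\<^sup>2)"
      using ex_signs_sum_squares_le[where F = F and n = N and b = b] by blast
    have b_sum: "(\<Sum>j<N. (b \<phi> j)\<^sup>2) \<le> \<delta> N * C" if \<phi>: "\<phi> \<in> F" for \<phi>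
    proof -
      have bump: "\<bar>\<phi> (Lp_bump (2 * N) i)\<bar> \<le> C * (2 * real N) powr (- 1 / p)" if "i < 2 * N" for i
        using C(2)[OF \<phi>, of "Lp_bump (2 * N) i"] Lp_norm_bump[of p i "2 * N"] p elim that
        by (simp add: Lp_bump_def Lp_step_in_Lp)
      have "(b \<phi> j)\<^sup>2 \<le> \<delta> N * \<bar>b \<phi> j\<bar>" if "j < N" for j
      proof -
        have "\<bar>b \<phi> j\<bar> \<le> \<delta> N"
          using bump[of "2 * j"] bump[of "2 * j + 1"] that unfolding b_def \<delta>_def by linarith
        from mult_right_mono[OF this, of "\<bar>b \<phi> j\<bar>"] show ?thesis
          by (simp add: power2_eq_square)
      qed
      then have "(\<Sum>j<N. (b \<phi> j)\<^sup>2) \<le> (\<Sum>j<N. \<delta> N * \<bar>b \<phi> j\<bar>)"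
        by (intro sum_mono) simp
      also have "\<dots> = \<delta> N * (\<Sum>j<N. \<bar>b \<phi> j\<bar>)"
        by (simp add: sum_distrib_left)
      also have "(\<Sum>j<N. \<bar>b \<phi> j\<bar>) \<le> (\<Sum>i<2 * N. \<bar>\<phi> (Lp_bump (2 * N) i)\<bar>)"
        unfolding sum_lessThan_double b_def by (intro sum_mono) (rule abs_triangle_ineq4)
      also have "\<dots> \<le> C"
        using p elim C(2)[OF \<phi>] dual[OF \<phi>] by (intro sum_abs_Lp_dual_bump_le[of _ p]) auto
      finally show ?thesis using C(1) by (simp add: \<delta>_def mult_left_mono)
    qed
    have "\<bar>\<phi> (Lp_step (2 * N) (haar_signs s))\<bar> < e" if \<phi>: "\<phi> \<in> F" for \<phi>
    proof -
      have "\<phi> (Lp_step (2 * N) (haar_signs s)) = (\<Sum>j<N. s j * b \<phi> j)"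
        using p elim
        by (simp add: Lp_dual_step[OF dual[OF \<phi>]] sum_lessThan_double haar_signs_def b_def
            right_diff_distrib)
      then have "(\<phi> (Lp_step (2 * N) (haar_signs s)))\<^sup>2 \<le> (\<Sum>\<phi>\<in>F. (\<Sum>j<N. s j * b \<phi> j)\<^sup>2)"
        using member_le_sum[of \<phi> F "\<lambda>\<phi>. (\<Sum>j<N. s j * b \<phi> j)\<^sup>2"] F(1) \<phi> by simp
      also note s(2)
      also have "(\<Sum>\<phi>\<in>F. \<Sum>j<N. (b \<phi> j)\<^sup>2) \<le> (\<Sum>\<phi>\<in>F. \<delta> N * C)"
        by (intro sum_mono b_sum)
      also have "\<dots> < e\<^sup>2" using elim by simp
      finally show ?thesis using e by (intro power2_less_imp_less[of "\<bar>_\<bar>"]) simp_all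
    qed
    then show ?case using s(1) by blast
  qed
qed

section \<open>The weak topology at 0 and the distance to the constant 1\<close>

text \<open>Induction over the generation of the topology: an intersection takes the union of the
  finite families and the smaller radius, a union needs only the member that contains 0.\<close>

lemma Lp_weak_neighbourhood_0:
  assumes "openin (Lp_weak_topology p) W" "0 \<in> W"
  obtains F e where "finite F" "F \<subseteq> Lp_dual p" "0 < e"
    "\<And>x. x \<in> Lp p \<Longrightarrow> (\<And>\<phi>. \<phi> \<in> F \<Longrightarrow> \<bar>\<phi> x\<bar> < e) \<Longrightarrow> x \<in> W"
proof -
  have "generate_topology_on {{x \<in> Lp p. \<phi> x \<in> U} | \<phi> U. \<phi> \<in> Lp_dual p \<and> open U} W"
    using assms(1) by (simp add: Lp_weak_topology_def openin_topology_generated_by_iff)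
  then have "\<exists>F e. finite F \<and> F \<subseteq> Lp_dual p \<and> 0 < e \<and> (\<forall>x\<in>Lp p. (\<forall>\<phi>\<in>F. \<bar>\<phi> x\<bar> < e) \<longrightarrow> x \<in> W)"
    using assms(2)
  proof induction
    case Empty
    then show ?case by simp
  next
    case (Int V W)
    from Int.IH(1) Int.prems obtain F e where
      F: "finite F" "F \<subseteq> Lp_dual p" "0 < e" "\<forall>x\<in>Lp p. (\<forall>\<phi>\<in>F. \<bar>\<phi> x\<bar> < e) \<longrightarrow> x \<in> V"
      by blast
    from Int.IH(2) Int.prems obtain H r where
      H: "finite H" "H \<subseteq> Lp_dual p" "0 < r" "\<forall>x\<in>Lp p. (\<forall>\<phi>\<in>H. \<bar>\<phi> x\<bar> < r) \<longrightarrow> x \<in> W"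
      by blast
    have "\<forall>x\<in>Lp p. (\<forall>\<phi>\<in>F \<union> H. \<bar>\<phi> x\<bar> < min e r) \<longrightarrow> x \<in> V \<inter> W"
      using F(4) H(4) by simp
    then show ?case
      using F(1-3) H(1-3) by (intro exI[of _ "F \<union> H"] exI[of _ "min e r"]) simp
  next
    case (UN \<W>)
    then obtain V where "V \<in> \<W>" "0 \<in> V" by blast
    with UN.IH[of V] show ?case by blast
  next
    case (Basis V)
    then obtain \<phi> U where V: "V = {x \<in> Lp p. \<phi> x \<in> U}" "\<phi> \<in> Lp_dual p" "open U" by blast
    then have "0 \<in> Lp p" "\<phi> 0 \<in> U" using Basis.prems by auto
    \<comment> \<open>Yields \<open>\<phi> 0 = 0\<close>, so a ball around \<open>\<phi> 0\<close>
      inside \<open>U\<close> is a bound on \<open>\<bar>\<phi> x\<bar>\<close>.\<close>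
    moreover have "\<phi> (0 *\<^sub>R 0) = 0 * \<phi> 0"
      using V(2) \<open>0 \<in> Lp p\<close> unfolding Lp_dual_def by blast
    ultimately obtain e where "0 < e" "ball 0 e \<subseteq> U"
      using V(3) by (auto simp: open_contains_ball)
    then show ?case
      using V by (intro exI[of _ "{\<phi>}"] exI[of _ e]) (auto simp: subset_iff)
  qed
  then show thesis using that by metis
qed

lemma topspace_Lp_weak_topology: "topspace (Lp_weak_topology p) = Lp p"
proof -
  have "(\<lambda>_. 0) \<in> Lp_dual p"
    unfolding Lp_dual_def by (auto intro!: exI[of _ 0])
  then have "Lp p \<in> {{x \<in> Lp p. \<phi> x \<in> U} | \<phi> U. \<phi> \<in> Lp_dual p \<and> open U}"
    by (auto intro!: exI[of _ "\<lambda>_. 0"] exI[of _ UNIV])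
  then show ?thesis
    unfolding Lp_weak_topology_def topology_generated_by_topspace by blast
qed

abbreviation Lp_one :: L0 where
  "Lp_one \<equiv> Lp_step 1 (\<lambda>_. 1)"

lemma Lp_dist_step_one: 
  "0 < N \<Longrightarrow> Lp_dist p (Lp_step N c) Lp_one = ((\<Sum>j<N. \<bar>c j - 1\<bar> powr p) / N) powr (1 / p)"
  unfolding Lp_dist_def Lp_step_const[of 1 1 N] Lp_step_diff[symmetric] by (rule Lp_norm_step)

lemma Lp_step_in_sphere:
  "0 < N \<Longrightarrow> (\<Sum>j<N. \<bar>c j\<bar> powr p) = N \<Longrightarrow> Lp_step N c \<in> Lp_sphere p"
  by (simp add: Lp_sphere_def Lp_step_in_Lp Lp_norm_step)

lemma sum_lessThan_bump:
  fixes a b :: real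
  shows "n < N \<Longrightarrow> (\<Sum>j<N. if j = n then a else b) = a + (real N - 1) * b"
  by (subst sum.remove[of _ n]) (auto simp: of_nat_diff)

lemma Lp_sphere_dist_one_not_weakly_continuous:
  assumes p: "1 < p" "p \<noteq> 2" and f: "continuous_map (Lp_weak_ball p) euclideanreal f"
    and dist: "\<And>x. x \<in> Lp_sphere p \<Longrightarrow> f x = Lp_dist p x Lp_one"
  shows False
proof -
  have zero: "0 \<in> Lp p" "Lp_norm p 0 = 0"
    using Lp_step_in_Lp[of 1 "\<lambda>_. 0" p] Lp_norm_step[of 1 p "\<lambda>_. 0"]
      Lp_step_scaleR[of 1 0 "\<lambda>_. 0"] by simp_all
  \<comment> \<open>The first inequality stays strict because sign functions have this exact
    distance to 1 for every N; the second is only a limit of strict inequalities.\<close>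
  have near: "\<bar>2 powr (1 - 1 / p) - f 0\<bar> < \<delta> \<and> \<bar>2 powr (1 / p) - f 0\<bar> \<le> \<delta>" if \<delta>: "0 < \<delta>" for \<delta>
  proof -
    have "openin (Lp_weak_ball p) {x \<in> topspace (Lp_weak_ball p). f x \<in> ball (f 0) \<delta>}"
      using f by (rule openin_continuous_map_preimage) simp
    then obtain W where W: "openin (Lp_weak_topology p) W"
      "{x \<in> topspace (Lp_weak_ball p). f x \<in> ball (f 0) \<delta>} = W \<inter> {x \<in> Lp p. Lp_norm p x \<le> 1}"
      unfolding Lp_weak_ball_def openin_subtopology by blast
    have top: "topspace (Lp_weak_ball p) = {x \<in> Lp p. Lp_norm p x \<le> 1}"
      unfolding Lp_weak_ball_def topspace_subtopology topspace_Lp_weak_topology by blast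
    have "0 \<in> W" using W(2) zero \<delta> unfolding top set_eq_iff
      by (metis (no_types, lifting) IntD1 centre_in_ball mem_Collect_eq zero_le_one)
    then obtain F e where F: "finite F" "F \<subseteq> Lp_dual p" "0 < e"
      "\<And>x. x \<in> Lp p \<Longrightarrow> (\<And>\<phi>. \<phi> \<in> F \<Longrightarrow> \<bar>\<phi> x\<bar> < e) \<Longrightarrow> x \<in> W"
      using Lp_weak_neighbourhood_0[OF W(1)] by metis
    have close: "\<bar>Lp_dist p x Lp_one - f 0\<bar> < \<delta>"
      if "x \<in> Lp_sphere p" "\<forall>\<phi>\<in>F. \<bar>\<phi> x\<bar> < e" for x
    proof -
      have "x \<in> W \<inter> {x \<in> Lp p. Lp_norm p x \<le> 1}"
        using that F(4)[of x] unfolding Lp_sphere_def by auto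
      then have "f x \<in> ball (f 0) \<delta>" unfolding W(2)[symmetric] by blast
      then show ?thesis using dist[OF that(1)] by (simp add: dist_real_def abs_minus_commute)
    qed
    have haar: "\<forall>\<^sub>F N in sequentially. \<bar>2 powr (1 - 1 / p) - f 0\<bar> < \<delta>"
      using eventually_ex_Lp_haar_near_0[OF p(1) F(1-3)] eventually_gt_at_top[of 0]
    proof eventually_elim
      case (elim N)
      then obtain s where s: "\<And>j. s j \<in> {1, - 1}"
        "\<forall>\<phi>\<in>F. \<bar>\<phi> (Lp_step (2 * N) (haar_signs s))\<bar> < e" by blast
      have abs: "\<bar>s j\<bar> = 1" for j using s(1)[of j] by auto
      have "\<bar>haar_signs s j\<bar> = 1" for j by (simp add: haar_signs_def abs)
      then have "Lp_step (2 * N) (haar_signs s) \<in> Lp_sphere p"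
        using elim by (intro Lp_step_in_sphere) auto
      note close[OF this s(2)]
      \<comment> \<open>In each pair one value is 1 and contributes 0, the other is -1 and
        contributes 2^p. Hence the integral is N 2^p / (2N).\<close>
      moreover have "\<bar>s j - 1\<bar> powr p + \<bar>- s j - 1\<bar> powr p = 2 powr p" for j
        using s(1)[of j] by auto
      then have "(\<Sum>j<2 * N. \<bar>haar_signs s j - 1\<bar> powr p) / real (2 * N) = 2 powr (p - 1)"
        using elim by (simp add: sum_lessThan_double haar_signs_def powr_diff)
      then have "Lp_dist p (Lp_step (2 * N) (haar_signs s)) Lp_one = (2 powr (p - 1)) powr (1 / p)"
        using elim Lp_dist_step_one[of "2 * N" p "haar_signs s"] by simp
      moreover have "(p - 1) * (1 / p) = 1 - 1 / p" using p by (simp add: field_simps)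
      ultimately show ?case by (simp only: powr_powr)
    qed
    have bump: "\<forall>\<^sub>F N in sequentially.
        \<bar>((\<bar>real N powr (1 / p) - 1\<bar> powr p + (real N - 1)) / N) powr (1 / p) - f 0\<bar> \<le> \<delta>"
      using eventually_ex_Lp_bump_near_0[OF p(1) F(1-3)] eventually_gt_at_top[of 0]
    proof eventually_elim
      case (elim N)
      define c where "c n i = (if i = n then real N powr (1 / p) else 0)" for n i :: nat
      obtain n where n: "n < N" "\<forall>\<phi>\<in>F. \<bar>\<phi> (Lp_step N (c n))\<bar> < e"
        using elim unfolding c_def by blast
      have "(\<Sum>j<N. \<bar>c n j\<bar> powr p) = (\<Sum>j<N. if j = n then real N else 0)"
        using p elim by (intro sum.cong) (auto simp: c_def powr_powr)
      then have "Lp_step N (c n) \<in> Lp_sphere p"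
        using elim n(1) by (intro Lp_step_in_sphere) (auto simp: sum_lessThan_bump)
      note close[OF this n(2)]
      moreover have "(\<Sum>j<N. \<bar>c n j - 1\<bar> powr p) =
          (\<Sum>j<N. if j = n then \<bar>real N powr (1 / p) - 1\<bar> powr p else 1)"
        by (intro sum.cong) (auto simp: c_def)
      then have "Lp_dist p (Lp_step N (c n)) Lp_one =
          ((\<bar>real N powr (1 / p) - 1\<bar> powr p + (real N - 1)) / N) powr (1 / p)"
        using elim n(1) Lp_dist_step_one[of N p "c n"] by (simp add: sum_lessThan_bump)
      ultimately show ?case by (simp only: less_imp_le)
    qed
    \<comment> \<open>Both |N^(1/p) - 1|^p / N and (N - 1) / N tend to 1: far out, the bump and the
      constant behave as if disjoint.\<close>
    have "((\<lambda>N. ((\<bar>real N powr (1 / p) - 1\<bar> powr p + (real N - 1)) / N) powr (1 / p)) \<longlongrightarrow>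
        2 powr (1 / p)) sequentially"
      using p by real_asymp
    then have "((\<lambda>N. \<bar>((\<bar>real N powr (1 / p) - 1\<bar> powr p + (real N - 1)) / N) powr (1 / p) - f 0\<bar>) \<longlongrightarrow>
        \<bar>2 powr (1 / p) - f 0\<bar>) sequentially"
      by (intro tendsto_rabs tendsto_diff tendsto_const)
    \<comment> \<open>The inequality in \<open>haar\<close> does not depend on N, so holding
      eventually it simply holds.\<close>
    from tendsto_upperbound[OF this bump] haar show ?thesis by simp
  qed
  have "\<bar>2 powr (1 - 1 / p) - f 0\<bar> \<le> 0" "\<bar>2 powr (1 / p) - f 0\<bar> \<le> 0"
    by (rule field_le_epsilon; use near in force)+
  then have "2 powr (1 - 1 / p) = (2 powr (1 / p) :: real)" by simp
  then have "1 - 1 / p = 1 / p" by (subst (asm) powr_inj) simp_all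
  then show False using p by (simp add: field_simps)
qed

section \<open>Excluding factor maps from the weak ball\<close>

text \<open>Composing \<open>f\<close> with a factor map would extend the distance to 1 weakly
  continuously. Only this one extension enters, so the lemma serves Gromov and equivariant
  compactifications alike.\<close>

lemma not_factor_of_Lp_weak_ball:
  assumes p: "1 < p" "p \<noteq> 2" and f: "continuous_map K euclideanreal f"
    and dist: "\<And>x. x \<in> Lp_sphere p \<Longrightarrow> f (\<gamma> x) = Lp_dist p x Lp_one"
  shows "\<not> compactification_factor (Lp_sphere_topology p) K \<gamma> (Lp_weak_ball p) (\<lambda>x. x)"
proof
  interpret S: Metric_space "Lp_sphere p" "Lp_dist p"
    using bounded_metric_space_Lp_sphere p by simp
  assume "compactification_factor (Lp_sphere_topology p) K \<gamma> (Lp_weak_ball p) (\<lambda>x. x)"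
  then obtain \<pi> where \<pi>: "continuous_map (Lp_weak_ball p) K \<pi>"
    "\<And>x. x \<in> Lp_sphere p \<Longrightarrow> \<pi> x = \<gamma> x"
    unfolding compactification_factor_def Lp_sphere_topology_def S.topspace_mtopology by blast
  have "(f \<circ> \<pi>) x = Lp_dist p x Lp_one" if "x \<in> Lp_sphere p" for x
    using dist[OF that] \<pi>(2)[OF that] by (simp only: o_apply)
  with p continuous_map_compose[OF \<pi>(1) f] show False
    by (rule Lp_sphere_dist_one_not_weakly_continuous)
qed

theorem theorem4p12:
  fixes p :: real
  assumes "1 < p" and "p \<noteq> 2"
  shows "(\<forall>(K :: 'k topology) \<gamma>.
            gromov_compactification (Lp_sphere p) (Lp_dist p) K \<gamma> \<longrightarrow>
            \<not> compactification_factor (Lp_sphere_topology p) K \<gamma> (Lp_weak_ball p) (\<lambda>x. x)) \<and>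
         \<not> maximal_equivariant_compactification
             (Lp_isometry_group p) (Lp_strong_operator_topology p)
             (Lp_sphere_topology p) (\<lambda>T x. T x) (Lp_weak_ball p) (\<lambda>T x. T x) (\<lambda>x. x) \<and>
         \<not> gromov_compactification (Lp_sphere p) (Lp_dist p) (Lp_weak_ball p) (\<lambda>x. x)"
proof -
  interpret S: Metric_space "Lp_sphere p" "Lp_dist p"
    using bounded_metric_space_Lp_sphere assms by simp
  have bdd: "S.mbounded (Lp_sphere p)"
    using bounded_metric_space_Lp_sphere assms by simp
  have one: "Lp_one \<in> Lp_sphere p" by (rule Lp_step_in_sphere) simp_all
  \<comment> \<open>Polymorphic in the points of \<open>K\<close>: it is applied to the
    compactification in the claim and to the weak ball itself.\<close>
  have gromov: "\<not> compactification_factor (Lp_sphere_topology p) K \<gamma> (Lp_weak_ball p) (\<lambda>x. x)"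
    if "gromov_compactification (Lp_sphere p) (Lp_dist p) K \<gamma>" for K :: "'l topology" and \<gamma>
    by (rule gromov_compactification_extends_dist[OF that one]) (rule not_factor_of_Lp_weak_ball[OF assms])
  have not_maximal: "\<not> maximal_equivariant_compactification
             (Lp_isometry_group p) (Lp_strong_operator_topology p)
             (Lp_sphere_topology p) (\<lambda>T x. T x) (Lp_weak_ball p) (\<lambda>T x. T x) (\<lambda>x. x)"
  proof
    assume max: "maximal_equivariant_compactification
             (Lp_isometry_group p) (Lp_strong_operator_topology p)
             (Lp_sphere_topology p) (\<lambda>T x. T x) (Lp_weak_ball p) (\<lambda>T x. T x) (\<lambda>x. x)"
    \<comment> \<open>Joint continuity of the action on the sphere is part of the assumed
      maximality, so it comes from \<open>max\<close>.\<close>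
    have GS: "G_space (Lp_isometry_group p) (Lp_strong_operator_topology p) S.mtopology (\<lambda>T x. T x)"
      using max unfolding maximal_equivariant_compactification_def equivariant_compactification_def
        Lp_sphere_topology_def by blast
    have iso: "Lp_dist p (T x) (T y) = Lp_dist p x y"
      if "T \<in> carrier (Lp_isometry_group p)" "x \<in> Lp_sphere p" "y \<in> Lp_sphere p" for T x y
    proof -
      have T: "\<And>x y. x \<in> Lp p \<Longrightarrow> y \<in> Lp p \<Longrightarrow> T (x + y) = T x + T y"
        "\<And>c x. x \<in> Lp p \<Longrightarrow> T (c *\<^sub>R x) = c *\<^sub>R T x"
        "\<And>x. x \<in> Lp p \<Longrightarrow> Lp_norm p (T x) = Lp_norm p x"
        using that(1) unfolding Lp_isometry_group_def Lp_isometries_def by auto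
      have xy: "x \<in> Lp p" "y \<in> Lp p" "- y \<in> Lp p"
        using that(2,3) Lp_uminus unfolding Lp_sphere_def by auto
      then have "x - y \<in> Lp p"
        using Lp_add_and_norm_triangle[of p x "- y"] assms by simp
      moreover have "T (x - y) = T x - T y"
        using T(1)[OF xy(1,3)] T(2)[OF xy(2), of "- 1"] by simp
      ultimately show ?thesis
        using T(3)[of "x - y"] by (simp add: Lp_dist_def)
    qed
    show False
    proof (rule ex_equivariant_compactification_extends_dist[OF S.Metric_space_axioms bdd GS iso])
      fix K :: "(L0 \<Rightarrow> real) topology" and actK \<gamma>
      assume K: "equivariant_compactification (Lp_isometry_group p) (Lp_strong_operator_topology p)
          S.mtopology (\<lambda>T x. T x) K actK \<gamma>"
        "\<And>z. z \<in> Lp_sphere p \<Longrightarrow> continuous_map K euclideanreal (\<lambda>k. k z)"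
        "\<And>x z. x \<in> Lp_sphere p \<Longrightarrow> z \<in> Lp_sphere p \<Longrightarrow> \<gamma> x z = Lp_dist p x z"
      \<comment> \<open>The points of \<open>K\<close> are functions on \<open>L0\<close>, not of
        the type in the definition of maximality; hence the transfer to arbitrary types.\<close>
      have "compactification_factor (Lp_sphere_topology p) K \<gamma> (Lp_weak_ball p) (\<lambda>x. x)"
        using maximal_equivariant_compactification_any_type[OF max, of K actK \<gamma>] K(1)
        unfolding Lp_sphere_topology_def by blast
      moreover have "\<not> compactification_factor (Lp_sphere_topology p) K \<gamma> (Lp_weak_ball p) (\<lambda>x. x)"
        by (rule not_factor_of_Lp_weak_ball[OF assms K(2)[OF one]]) (rule K(3)[OF _ one])
      ultimately show False by blast
    qed
  qed
  \<comment> \<open>The weak ball is a factor of itself, so being the Gromov compactification would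
    contradict \<open>gromov\<close>.\<close>
  have "compactification_factor (Lp_sphere_topology p) (Lp_weak_ball p) (\<lambda>x. x) (Lp_weak_ball p) (\<lambda>x. x)"
    unfolding compactification_factor_def by (intro exI[of _ "\<lambda>x. x"]) simp
  then have "\<not> gromov_compactification (Lp_sphere p) (Lp_dist p) (Lp_weak_ball p) (\<lambda>x. x)"
    using gromov by blast
  then show ?thesis by (intro conjI allI impI gromov not_maximal)
qed

end
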